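(* Let $H$ be a graph with a fixed cyclic ample framing. The map $\Phi_H$, sending a maximal clique $K$ to the flow $\Phi_H(K)(e)=n_K(e)-1$, is a bijection between the maximal cliques of $H$ and the cyclic volume integer flows of $H$.
   Context: $H=(V,E)$ is a finite directed graph (possibly with directed cycles), sources and sinks of degree one, no idle edges, every internal vertex of indegree and outdegree 2. Minimal cycles: directed cycles with no proper subset a directed cycle. Routes: minimal cycles and directed source-to-sink walks; a walk is good if it does not contain all edges of a minimal cycle consecutively; $\mathrm{Routes}(H)$ = minimal cycles and good routes. Cyclic ample framing: red/blue edge colouring, distinct colours on the two incoming and two outgoing edges at each internal vertex, every minimal cycle monochromatic. Routes $\rho,\rho'$ are incompatible if both are source-to-sink walks and there is a common subwalk $S$ (possibly a vertex) with $\rho=PSQ$, $\rho'=P'SQ'$, last edge of $P$ and first edge of $Q'$ blue, first edge of $Q$ and last edge of $P'$ red; otherwise compatible. A clique is a subset of $\mathrm{Routes}(H)$ of pairwise compatible routes; maximal cliques are inclusion-maximal. For a good route $\rho$ containing $e$, its prefix up to $e$ is the initial subwalk of $\rho$ ending with $e$; for a minimal cycle $C\ni e$ the prefix is $C$ itself. $n_K(e)$ is the number of distinct prefixes up to $e$ among routes of $K$ containing $e$. Netflow at $v$: outflow minus inflow. A cyclic volume integer flow is $f:E\to\mathbb{Z}_{\ge0}$ with netflow 0 at every source such that every minimal cycle $C$ has exactly one edge $e_C$ with $f(e_C)=0$ and the netflow is 1 at every internal vertex except at the tails of the $e_C$, where it is 0.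
   Formalization: Added assumption: no loop is based at a vertex of a minimal cycle with two or more edges (void for loopless graphs). Without it the claim fails, e.g. red s→v→t, blue 2-cycle u⇄v, red loop at u: one maximal clique but no cyclic volume integer flow. *)

theory Defs
  imports "HOL-Library.FuncSet" "Graph_Theory.Graph_Theory"
begin

text \<open>
  Graphs are multigraphs (loops and parallel arcs are allowed) in the format of the Graph_Theory
  library, and walks are lists of arcs.
\<close>

definition source :: "('a, 'b) pre_digraph \<Rightarrow> 'a \<Rightarrow> bool" where
  "source H v \<longleftrightarrow> v \<in> verts H \<and> in_degree H v = 0"

definition sink :: "('a, 'b) pre_digraph \<Rightarrow> 'a \<Rightarrow> bool" where
  "sink H v \<longleftrightarrow> v \<in> verts H \<and> out_degree H v = 0"

definition internal :: "('a, 'b) pre_digraph \<Rightarrow> 'a \<Rightarrow> bool" where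
  "internal H v \<longleftrightarrow> v \<in> verts H \<and> \<not> source H v \<and> \<not> sink H v"

definition idle :: "('a, 'b) pre_digraph \<Rightarrow> 'b \<Rightarrow> bool" where
  "idle H e \<longleftrightarrow> e \<in> arcs H \<and>
     (internal H (tail H e) \<and> out_arcs H (tail H e) = {e} \<or>
      internal H (head H e) \<and> in_arcs H (head H e) = {e})"

text \<open>
  The assumption \<open>no_idle\<close> follows from \<open>internal_degree\<close>; it is listed because it belongs to the
  customary definition of this class of graphs.
\<close>

locale full_graph = fin_digraph H for H :: "('a, 'b) pre_digraph" +
  assumes source_degree: "source H v \<Longrightarrow> in_degree H v + out_degree H v = 1"
    and sink_degree: "sink H v \<Longrightarrow> in_degree H v + out_degree H v = 1"
    and internal_degree: "internal H v \<Longrightarrow> in_degree H v = 2 \<and> out_degree H v = 2"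
    and no_idle: "\<not> idle H e"

text \<open>
  Directed cycles are identified with their arc sets, so that the base point of a cycle is
  irrelevant and minimality refers to inclusion of arc sets. A loop is a cycle with one arc.
\<close>

definition directed_cycle :: "('a, 'b) pre_digraph \<Rightarrow> 'b set \<Rightarrow> bool" where
  "directed_cycle H C \<longleftrightarrow> (\<exists>p. pre_digraph.cycle H p \<and> C = set p)"

definition minimal_cycle :: "('a, 'b) pre_digraph \<Rightarrow> 'b set \<Rightarrow> bool" where
  "minimal_cycle H C \<longleftrightarrow> directed_cycle H C \<and> (\<forall>D. D \<subset> C \<longrightarrow> \<not> directed_cycle H D)"

text \<open>
  No loop is based at a vertex of a minimal cycle with more than one arc.

  The correspondence between maximal cliques and flows fails without this condition. For example,
  let the internal vertices be \<open>u\<close> and \<open>v\<close>, with red arcs \<open>s \<rightarrow> v \<rightarrow> t\<close>, a blue cycle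
  \<open>u \<rightarrow> v \<rightarrow> u\<close> and a red loop at \<open>u\<close>. The routes are the two cycles and the walk \<open>s \<rightarrow> v \<rightarrow> t\<close>.
  They form the only maximal clique, whose image vanishes on both arcs of the blue cycle; and there
  is no cyclic volume integer flow at all. The condition is void for graphs without loops.
\<close>

definition loops_avoid_longer_cycles :: "('a, 'b) pre_digraph \<Rightarrow> bool" where
  "loops_avoid_longer_cycles H \<longleftrightarrow>
     (\<forall>e \<in> arcs H. \<forall>C. tail H e = head H e \<and> minimal_cycle H C \<and> tail H e \<in> tail H ` C
        \<longrightarrow> card C = 1)"

datatype colour = Red | Blue

definition cyclic_ample_framing :: "('a, 'b) pre_digraph \<Rightarrow> ('b \<Rightarrow> colour) \<Rightarrow> bool" where
  "cyclic_ample_framing H col \<longleftrightarrow>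
     (\<forall>v. internal H v \<longrightarrow> inj_on col (in_arcs H v) \<and> inj_on col (out_arcs H v)) \<and>
     (\<forall>C. minimal_cycle H C \<longrightarrow> (\<forall>e \<in> C. \<forall>e' \<in> C. col e = col e'))"

definition source_sink_walk :: "('a, 'b) pre_digraph \<Rightarrow> 'b list \<Rightarrow> bool" where
  "source_sink_walk H p \<longleftrightarrow> (\<exists>s t. source H s \<and> sink H t \<and> pre_digraph.awalk H s p t)"

definition good_walk :: "('a, 'b) pre_digraph \<Rightarrow> 'b list \<Rightarrow> bool" where
  "good_walk H p \<longleftrightarrow> source_sink_walk H p \<and>
     \<not> (\<exists>xs ys zs. p = xs @ ys @ zs \<and> minimal_cycle H (set ys))"

datatype 'b route = Cycle "'b set" | Walk "'b list"

definition Routes :: "('a, 'b) pre_digraph \<Rightarrow> 'b route set" where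
  "Routes H = Cycle ` {C. minimal_cycle H C} \<union> Walk ` {p. good_walk H p}"

text \<open>
  The common subwalk \<open>S\<close> may be a single vertex; it is then represented by the empty list, and the
  equation between the heads says that both walks pass through that vertex. (If \<open>S\<close> has an arc,
  the equation holds automatically.)
\<close>

definition crossing ::
    "('a, 'b) pre_digraph \<Rightarrow> ('b \<Rightarrow> colour) \<Rightarrow> 'b list \<Rightarrow> 'b list \<Rightarrow> bool" where
  "crossing H col p p' \<longleftrightarrow>
     (\<exists>P S Q P' Q'. p = P @ S @ Q \<and> p' = P' @ S @ Q' \<and>
        P \<noteq> [] \<and> Q \<noteq> [] \<and> P' \<noteq> [] \<and> Q' \<noteq> [] \<and>
        head H (last P) = head H (last P') \<and>
        col (last P) = Blue \<and> col (hd Q') = Blue \<and>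
        col (hd Q) = Red \<and> col (last P') = Red)"

fun incompatible ::
    "('a, 'b) pre_digraph \<Rightarrow> ('b \<Rightarrow> colour) \<Rightarrow> 'b route \<Rightarrow> 'b route \<Rightarrow> bool" where
  "incompatible H col (Walk p) (Walk p') \<longleftrightarrow> crossing H col p p' \<or> crossing H col p' p"
| "incompatible H col _ _ \<longleftrightarrow> False"

definition clique :: "('a, 'b) pre_digraph \<Rightarrow> ('b \<Rightarrow> colour) \<Rightarrow> 'b route set \<Rightarrow> bool" where
  "clique H col K \<longleftrightarrow>
     K \<subseteq> Routes H \<and> pairwise (\<lambda>\<rho> \<rho>'. \<not> incompatible H col \<rho> \<rho>') K"

definition maximal_cliques ::
    "('a, 'b) pre_digraph \<Rightarrow> ('b \<Rightarrow> colour) \<Rightarrow> 'b route set set" where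
  "maximal_cliques H col = {K. clique H col K \<and> (\<forall>K'. clique H col K' \<and> K \<subseteq> K' \<longrightarrow> K' = K)}"

text \<open>
  The set of prefixes of a route up to \<open>e\<close>. It is empty if the route does not contain \<open>e\<close>, and
  otherwise a singleton for every element of \<^term>\<open>Routes H\<close>: a good walk does not repeat arcs.
\<close>

fun prefixes_upto :: "'b \<Rightarrow> 'b route \<Rightarrow> 'b route set" where
  "prefixes_upto e (Cycle C) = (if e \<in> C then {Cycle C} else {})"
| "prefixes_upto e (Walk p) = {Walk (xs @ [e]) | xs ys. p = xs @ e # ys}"

definition num_prefixes :: "'b route set \<Rightarrow> 'b \<Rightarrow> nat" where
  "num_prefixes K e = card (\<Union>\<rho> \<in> K. prefixes_upto e \<rho>)"

text \<open>
  Functions on the arcs are extensional, i.e. equal to \<^term>\<open>undefined\<close> outside \<^term>\<open>arcs H\<close>.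
\<close>

definition clique_flow :: "('a, 'b) pre_digraph \<Rightarrow> 'b route set \<Rightarrow> 'b \<Rightarrow> int" where
  "clique_flow H K = (\<lambda>e \<in> arcs H. int (num_prefixes K e) - 1)"

definition netflow :: "('a, 'b) pre_digraph \<Rightarrow> ('b \<Rightarrow> int) \<Rightarrow> 'a \<Rightarrow> int" where
  "netflow H f v = (\<Sum>e \<in> out_arcs H v. f e) - (\<Sum>e \<in> in_arcs H v. f e)"

definition zero_tails :: "('a, 'b) pre_digraph \<Rightarrow> ('b \<Rightarrow> int) \<Rightarrow> 'a set" where
  "zero_tails H f = {tail H e | e C. minimal_cycle H C \<and> e \<in> C \<and> f e = 0}"

definition cyclic_volume_integer_flows :: "('a, 'b) pre_digraph \<Rightarrow> ('b \<Rightarrow> int) set" where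
  "cyclic_volume_integer_flows H =
     {f \<in> arcs H \<rightarrow>\<^sub>E {0..}.
        (\<forall>v. source H v \<longrightarrow> netflow H f v = 0) \<and>
        (\<forall>C. minimal_cycle H C \<longrightarrow> (\<exists>!e. e \<in> C \<and> f e = 0)) \<and>
        (\<forall>v. internal H v \<longrightarrow> netflow H f v = (if v \<in> zero_tails H f then 0 else 1))}"

end

theory Submission
  imports Defs
begin

text \<open>
  All simple directed cycles are minimal, hence monochromatic, and every clique leaves an arc of
  each minimal cycle unused: otherwise the extreme prefix at one arc of the cycle could be followed
  around the whole cycle. One may therefore cut every minimal cycle at an unused arc, and the
  incidence forest of the cycles allows one to do so without disconnecting any vertex. Outside the
  cut arcs the graph is acyclic. Prefixes ending at a vertex are linearly ordered by the colour of
  the arcs at which they last merge, and in a clique the prefixes continuing along an out-arc form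
  an initial segment for the order attached to the colour of that arc. In a maximal clique the two
  segments at a vertex with two uncut out-arcs overlap in exactly one prefix, which is the netflow
  condition. Conversely the sizes of the segments determine all prefixes by recursion along the
  acyclic part, so the clique can be reconstructed from its flow.
\<close>

section \<open>Linked arc lists and minimal cycles\<close>

text \<open>The counting needs every uncut arc to be used. Hence cuts are chosen with distinct heads
  and distinct tails, loops apart. On the side of flows the cuts are forced: they are the zeros on
  the cycles. Let \<open>m e\<close> count the walk prefixes ending with \<open>e\<close>. Distinct
  minimal cycles share no arc and a maximal clique contains all of them, so the flow is
  \<open>m e\<close> on cycle arcs and \<open>m e - 1\<close> elsewhere. At an internal vertex these
  shifts cancel, because in-arcs and out-arcs of the same colour lie on the same cycles. So both
  sides reduce to weights \<open>m\<close> with excess 1 at each internal vertex, or 0 if an out-arc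
  there is cut.\<close>

lemma not_distinct_map_decomp:
  assumes "\<not> distinct (map f p)"
  obtains a x b y c where "p = a @ x # b @ y # c" "f x = f y"
proof -
  have "\<exists>a x b y c. p = a @ x # b @ y # c \<and> f x = f y"
    using assms
  proof (induction p)
    case (Cons z p)
    show ?case
    proof (cases "f z \<in> f ` set p")
      case True
      then obtain y where "y \<in> set p" "f z = f y" by auto
      then obtain b c where "p = b @ y # c" by (meson split_list)
      then have "z # p = [] @ z # b @ y # c" by simp
      then show ?thesis using \<open>f z = f y\<close> by blast
    next
      case False
      then have "\<not> distinct (map f p)" using Cons.prems by auto
      then obtain a x b y c where "p = a @ x # b @ y # c" "f x = f y" using Cons.IH by blast
      then have "z # p = (z # a) @ x # b @ y # c" by simp
      then show ?thesis using \<open>f x = f y\<close> by blast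
    qed
  qed simp
  then show thesis using that by blast
qed

locale framed_graph = full_graph H for H :: "('a, 'b) pre_digraph" +
  fixes col :: "'b \<Rightarrow> colour"
  assumes framing: "cyclic_ample_framing H col"
    and loops: "loops_avoid_longer_cycles H"
begin

lemma not_source_head: "e \<in> arcs H \<Longrightarrow> \<not> source H (head H e)"
  unfolding source_def in_degree_def by (auto simp: in_arcs_def)

lemma not_sink_tail: "e \<in> arcs H \<Longrightarrow> \<not> sink H (tail H e)"
  unfolding sink_def out_degree_def by (auto simp: out_arcs_def)

lemma not_internal_head: "e \<in> arcs H \<Longrightarrow> \<not> internal H (head H e) \<Longrightarrow> sink H (head H e)"
  using not_source_head by (auto simp: internal_def)

lemma not_internal_tail: "e \<in> arcs H \<Longrightarrow> \<not> internal H (tail H e) \<Longrightarrow> source H (tail H e)"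
  using not_sink_tail by (auto simp: internal_def)

lemma internal_not_source: "internal H v \<Longrightarrow> \<not> source H v"
  and internal_not_sink: "internal H v \<Longrightarrow> \<not> sink H v"
  by (auto simp: internal_def)

lemma internal_between:
  assumes "e \<in> arcs H" "e' \<in> arcs H" "head H e = tail H e'"
  shows "internal H (head H e)" "internal H (tail H e')"
  using assms not_source_head[of e] not_sink_tail[of e'] head_in_verts[of e]
  by (auto simp: internal_def)

lemma colour_set: "S = UNIV" if "card S = 2" for S :: "colour set"
proof -
  have U: "(UNIV :: colour set) = {Red, Blue}" using colour.exhaust by auto
  have "card (UNIV :: colour set) = 2" "finite (UNIV :: colour set)" unfolding U by auto
  then show ?thesis using that by (metis card_subset_eq subset_UNIV)
qed

lemma colour_neq: "(c :: colour) \<noteq> c' \<Longrightarrow> d \<noteq> c \<Longrightarrow> d = c'"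
  by (cases c; cases c'; cases d) auto

lemma colour_arc:
  assumes "internal H v"
  shows "\<exists>e \<in> in_arcs H v. col e = c" "\<exists>e \<in> out_arcs H v. col e = c"
proof -
  have "inj_on col (in_arcs H v)" "inj_on col (out_arcs H v)"
    using framing assms by (auto simp: cyclic_ample_framing_def)
  moreover have "card (in_arcs H v) = 2" "card (out_arcs H v) = 2"
    using internal_degree[OF assms] by (auto simp: in_degree_def out_degree_def)
  ultimately have "col ` in_arcs H v = UNIV" "col ` out_arcs H v = UNIV"
    by (auto intro!: colour_set simp: card_image)
  then show "\<exists>e \<in> in_arcs H v. col e = c" "\<exists>e \<in> out_arcs H v. col e = c"
    by (metis UNIV_I imageE)+
qed

lemma source_out_arc:
  assumes "source H v" "e \<in> out_arcs H v"
  shows "out_arcs H v = {e}"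
proof -
  have "card (out_arcs H v) = 1"
    using source_degree[OF assms(1)] assms(1) by (auto simp: source_def out_degree_def)
  then obtain x where "out_arcs H v = {x}" by (rule card_1_singletonE)
  then show ?thesis using assms(2) by simp
qed

lemma sink_in_arc:
  assumes "sink H v" "e \<in> in_arcs H v"
  shows "in_arcs H v = {e}"
proof -
  have "card (in_arcs H v) = 1"
    using sink_degree[OF assms(1)] assms(1) by (auto simp: sink_def in_degree_def)
  then obtain x where "in_arcs H v = {x}" by (rule card_1_singletonE)
  then show ?thesis using assms(2) by simp
qed

text \<open>A source has a single out-arc, so colours separate out-arcs at every tail, although the
  framing only speaks of internal vertices.\<close>

lemma out_arc_eq:
  assumes "e \<in> arcs H" "e' \<in> arcs H" "tail H e = tail H e'" "col e = col e'"
  shows "e = e'"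
proof (cases "internal H (tail H e)")
  case True
  then have "inj_on col (out_arcs H (tail H e))" using framing by (auto simp: cyclic_ample_framing_def)
  then show ?thesis using assms by (auto simp: inj_on_def)
next
  case False
  then have "out_arcs H (tail H e) = {e}"
    using source_out_arc[OF not_internal_tail[OF assms(1)]] assms(1) by auto
  then show ?thesis using assms by auto
qed

lemma in_arc_eq:
  assumes "e \<in> arcs H" "e' \<in> arcs H" "head H e = head H e'" "col e = col e'"
  shows "e = e'"
proof (cases "internal H (head H e)")
  case True
  then have "inj_on col (in_arcs H (head H e))" using framing by (auto simp: cyclic_ample_framing_def)
  then show ?thesis using assms by (auto simp: inj_on_def)
next
  case False
  then have "in_arcs H (head H e) = {e}"
    using sink_in_arc[OF not_internal_head[OF assms(1)]] assms(1) by auto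
  then show ?thesis using assms by auto
qed

lemma in_arcs_pair:
  assumes "internal H v"
  obtains e e' where "in_arcs H v = {e, e'}" "e \<noteq> e'" "col e \<noteq> col e'"
proof -
  obtain e e' where e: "e \<in> in_arcs H v" "col e = Red" "e' \<in> in_arcs H v" "col e' = Blue"
    using colour_arc(1)[OF assms] by metis
  have "x \<in> {e, e'}" if "x \<in> in_arcs H v" for x
    using that e in_arc_eq[of x e] in_arc_eq[of x e'] by (cases "col x") auto
  then show thesis using that e by (metis colour.distinct(1) empty_subsetI insert_subset subsetI subset_antisym)
qed

lemma out_arcs_pair:
  assumes "internal H v" "e \<in> out_arcs H v"
  obtains e' where "out_arcs H v = {e, e'}" "e \<noteq> e'" "col e \<noteq> col e'"
proof -
  define c where "c = (if col e = Red then Blue else Red)"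
  have c: "col e \<noteq> c" unfolding c_def by auto
  obtain e' where e: "e' \<in> out_arcs H v" "col e' = c"
    using colour_arc(2)[OF assms(1)] by metis
  have "x \<in> {e, e'}" if "x \<in> out_arcs H v" for x
  proof (cases "col x = col e")
    case True
    then show ?thesis using that assms(2) out_arc_eq[of x e] by auto
  next
    case False
    then have "col x = c" using colour_neq[OF c] by simp
    then show ?thesis using that e out_arc_eq[of x e'] by auto
  qed
  then have "out_arcs H v = {e, e'}" using e(1) assms(2) by blast
  then show thesis using that e c by auto
qed

text \<open>Unlike in \<open>awalk\<close>, no end vertices are named, so lists can be split and
  joined freely.\<close>

definition linked :: "'b list \<Rightarrow> bool" where
  "linked p \<longleftrightarrow> set p \<subseteq> arcs H \<and> successively (\<lambda>a b. head H a = tail H b) p"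

lemma linked_Nil [simp]: "linked []"
  by (simp add: linked_def)

lemma linked_single [simp]: "linked [e] \<longleftrightarrow> e \<in> arcs H"
  by (simp add: linked_def)

lemma linked_append:
  "linked (p @ q) \<longleftrightarrow> linked p \<and> linked q \<and> (p = [] \<or> q = [] \<or> head H (last p) = tail H (hd q))"
  by (auto simp: linked_def successively_append_iff)

lemma linked_Cons:
  "linked (e # q) \<longleftrightarrow> e \<in> arcs H \<and> linked q \<and> (q = [] \<or> head H e = tail H (hd q))"
  using linked_append[of "[e]" q] by auto

lemma linked_arcs: "linked p \<Longrightarrow> set p \<subseteq> arcs H"
  by (simp add: linked_def)

lemma awalk_linked:
  assumes "p \<noteq> []"
  shows "awalk u p v \<longleftrightarrow> linked p \<and> tail H (hd p) = u \<and> head H (last p) = v"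
  using assms
proof (induction p arbitrary: u)
  case (Cons e p)
  show ?case
  proof (cases "p = []")
    case True
    then show ?thesis by (auto simp: awalk_simps)
  next
    case False
    then show ?thesis using Cons.IH[OF False, of "head H e"]
      by (auto simp: awalk_Cons_iff linked_Cons)
  qed
qed simp

lemma directed_cycle_iff:
  "directed_cycle H C \<longleftrightarrow>
     (\<exists>p. p \<noteq> [] \<and> linked p \<and> head H (last p) = tail H (hd p) \<and> distinct (map (head H) p) \<and> C = set p)"
proof -
  have "tl (awalk_verts u p) = map (head H) p" if "awalk u p u" "p \<noteq> []" for u p
    using that awalk_verts_conv'[of u p u] by (auto simp: awalk_def)
  then have "cycle p \<longleftrightarrow> p \<noteq> [] \<and> linked p \<and> head H (last p) = tail H (hd p) \<and> distinct (map (head H) p)" for p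
    unfolding cycle_def using awalk_linked[of p] by metis
  then show ?thesis unfolding directed_cycle_def by auto
qed

lemma directed_cycleE:
  assumes "directed_cycle H C"
  obtains p where "p \<noteq> []" "linked p" "head H (last p) = tail H (hd p)"
    "distinct (map (head H) p)" "C = set p"
  using assms directed_cycle_iff by auto

lemma directed_cycle_arcs: "directed_cycle H C \<Longrightarrow> C \<subseteq> arcs H"
  by (auto elim!: directed_cycleE dest: linked_arcs)

lemma directed_cycle_nonempty: "directed_cycle H C \<Longrightarrow> C \<noteq> {}"
  by (auto elim!: directed_cycleE)

lemma directed_cycle_head_inj: "directed_cycle H C \<Longrightarrow> inj_on (head H) C"
  by (auto elim!: directed_cycleE simp: distinct_map)

lemma cycle_listE:
  assumes "directed_cycle H C" "e \<in> C"
  obtains p where "p \<noteq> []" "linked p" "hd p = e" "head H (last p) = tail H e" "distinct p" "C = set p"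
proof -
  obtain p where p: "p \<noteq> []" "linked p" "head H (last p) = tail H (hd p)"
    "distinct (map (head H) p)" "C = set p"
    using assms(1) by (rule directed_cycleE)
  obtain xs ys where xy: "p = xs @ e # ys" using p(5) assms(2) by (meson split_list)
  show thesis
  proof (rule that[of "e # ys @ xs"])
    show "linked (e # ys @ xs)"
      using p(2,3) unfolding xy
      by (cases "xs = []"; cases "ys = []") (auto simp: linked_append linked_Cons)
    show "head H (last (e # ys @ xs)) = tail H e"
      using p(2,3) unfolding xy by (cases "xs = []") (auto simp: linked_append linked_Cons)
  qed (use p xy in \<open>auto simp: distinct_map\<close>)
qed

lemma directed_cycle_succ:
  assumes "directed_cycle H C" "e \<in> C"
  shows "\<exists>e' \<in> C. tail H e' = head H e"
proof -
  obtain p where p: "p \<noteq> []" "linked p" "hd p = e" "head H (last p) = tail H e" "C = set p"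
    using assms by (rule cycle_listE)
  show ?thesis
  proof (cases "tl p")
    case Nil
    then have "p = [e]" using p by (cases p) auto
    then show ?thesis using p by auto
  next
    case (Cons e' q)
    then have "p = e # e' # q" using p by (cases p) auto
    then show ?thesis using p by (auto simp: linked_Cons)
  qed
qed

lemma directed_cycle_pred:
  assumes "directed_cycle H C" "e \<in> C"
  shows "\<exists>e' \<in> C. head H e' = tail H e"
  by (rule cycle_listE[OF assms]) (metis last_in_set)

text \<open>The closed list is opened at an arc of \<open>X\<close>. Its last arc precedes that arc,
  so it lies in \<open>X\<close>, and going backwards through the list every arc follows it into
  \<open>X\<close>.\<close>

lemma directed_cycle_pred_closed:
  assumes "directed_cycle H C" "X \<subseteq> C" "X \<noteq> {}"
    and closed: "\<And>e e'. e \<in> X \<Longrightarrow> e' \<in> C \<Longrightarrow> head H e' = tail H e \<Longrightarrow> e' \<in> X"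
  shows "X = C"
proof -
  obtain e where e: "e \<in> X" "e \<in> C" using assms by auto
  obtain p where p: "p \<noteq> []" "linked p" "hd p = e" "head H (last p) = tail H e" "distinct p" "C = set p"
    using assms(1) e(2) by (rule cycle_listE)
  have "set q \<subseteq> X" if "p = r @ q" for r q
    using that
  proof (induction q arbitrary: r)
    case (Cons x q)
    have "set q \<subseteq> X" using Cons.IH[of "r @ [x]"] Cons.prems by auto
    moreover have "x \<in> X"
    proof (cases q)
      case Nil
      then have "last p = x" using Cons.prems by auto
      then show ?thesis using closed[OF e(1), of x] p Cons.prems by auto
    next
      case (Cons y q')
      then have "y \<in> X" "head H x = tail H y"
        using \<open>set q \<subseteq> X\<close> Cons.prems p(2) by (auto simp: linked_append linked_Cons)
      then show ?thesis using closed[of y x] p Cons.prems by auto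
    qed
    ultimately show ?case by simp
  qed simp
  from this[of "[]" p] show ?thesis using p assms(2) by auto
qed

text \<open>Heads are distinct on a simple cycle, so an arc of \<open>C\<close> has only one
  predecessor inside \<open>C\<close>. A directed cycle \<open>D\<close> inside \<open>C\<close>
  contains that predecessor along with the arc, hence is closed under predecessors.\<close>

lemma directed_cycle_minimal: "directed_cycle H C \<Longrightarrow> minimal_cycle H C"
  unfolding minimal_cycle_def
proof (intro conjI allI impI notI)
  fix D assume C: "directed_cycle H C" and D: "D \<subset> C" "directed_cycle H D"
  have "D = C"
  proof (rule directed_cycle_pred_closed[OF C])
    fix e e' assume e: "e \<in> D" "e' \<in> C" "head H e' = tail H e"
    obtain e'' where "e'' \<in> D" "head H e'' = tail H e" using directed_cycle_pred[OF D(2) e(1)] by auto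
    then have "e'' = e'" using e D directed_cycle_head_inj[OF C] unfolding inj_on_def by (metis psubsetD)
    then show "e' \<in> D" using \<open>e'' \<in> D\<close> by simp
  qed (use D directed_cycle_nonempty in auto)
  then show False using D by auto
qed

lemma minimal_cycle_directed: "minimal_cycle H C \<Longrightarrow> directed_cycle H C"
  by (simp add: minimal_cycle_def)

lemma minimal_cycle_arcs: "minimal_cycle H C \<Longrightarrow> e \<in> C \<Longrightarrow> e \<in> arcs H"
  using directed_cycle_arcs minimal_cycle_directed by auto

lemma minimal_cycle_colour: "minimal_cycle H C \<Longrightarrow> e \<in> C \<Longrightarrow> e' \<in> C \<Longrightarrow> col e = col e'"
  using framing unfolding cyclic_ample_framing_def by blast

lemma minimal_cycle_internal:
  assumes "minimal_cycle H C" "e \<in> C"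
  shows "internal H (head H e)" "internal H (tail H e)"
proof -
  note C = minimal_cycle_directed[OF assms(1)]
  obtain a b where "a \<in> C" "tail H a = head H e" "b \<in> C" "head H b = tail H e"
    using directed_cycle_succ[OF C assms(2)] directed_cycle_pred[OF C assms(2)] by auto
  then show "internal H (head H e)" "internal H (tail H e)"
    using internal_between[of e a] internal_between[of b e] minimal_cycle_arcs[OF assms(1)] assms(2) by auto
qed

text \<open>\<open>C\<close> enters the tail of \<open>e\<close> by an arc of the colour of
  \<open>e\<close>, and the framing allows only one such in-arc.\<close>

lemma minimal_cycle_pred_unique:
  assumes "minimal_cycle H C" "e \<in> C" "e' \<in> arcs H" "head H e' = tail H e" "col e' = col e"
  shows "e' \<in> C"
proof -
  obtain b where "b \<in> C" "head H b = tail H e"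
    using directed_cycle_pred[OF minimal_cycle_directed[OF assms(1)] assms(2)] by auto
  then show ?thesis
    using in_arc_eq[of b e'] assms minimal_cycle_arcs[OF assms(1)] minimal_cycle_colour[OF assms(1)] by metis
qed

lemma minimal_cycle_succ_unique:
  assumes "minimal_cycle H C" "e \<in> C" "e' \<in> arcs H" "tail H e' = head H e" "col e' = col e"
  shows "e' \<in> C"
proof -
  obtain b where "b \<in> C" "tail H b = head H e"
    using directed_cycle_succ[OF minimal_cycle_directed[OF assms(1)] assms(2)] by auto
  then show ?thesis
    using out_arc_eq[of b e'] assms minimal_cycle_arcs[OF assms(1)] minimal_cycle_colour[OF assms(1)] by metis
qed

text \<open>A common arc drags its predecessor in either cycle into the intersection, since that
  predecessor is determined by its colour.\<close>

lemma minimal_cycle_eq: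
  assumes "minimal_cycle H C" "minimal_cycle H D" "e \<in> C" "e \<in> D"
  shows "C = D"
proof -
  have "C \<inter> D = X" if X: "X \<in> {C, D}" for X
  proof (rule directed_cycle_pred_closed)
    fix a b assume "a \<in> C \<inter> D" "b \<in> X" "head H b = tail H a"
    then have "b \<in> arcs H" "col b = col a"
      using X assms(1,2) minimal_cycle_arcs[of X b] minimal_cycle_colour[of X b a]
        \<open>a \<in> C \<inter> D\<close> \<open>b \<in> X\<close> by blast+
    then show "b \<in> C \<inter> D"
      using minimal_cycle_pred_unique[OF assms(1), of a b] minimal_cycle_pred_unique[OF assms(2), of a b]
        \<open>a \<in> C \<inter> D\<close> \<open>head H b = tail H a\<close> by simp
  qed (use assms X minimal_cycle_directed in auto)
  then show ?thesis by blast
qed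

text \<open>The condition on good walks without the end conditions, so that it also applies to
  prefixes and inner pieces.\<close>

definition cycle_free :: "'b list \<Rightarrow> bool" where
  "cycle_free p \<longleftrightarrow> \<not> (\<exists>xs ys zs. p = xs @ ys @ zs \<and> minimal_cycle H (set ys))"

lemma cycle_free_sublist: "cycle_free (a @ b @ c) \<Longrightarrow> cycle_free b"
  unfolding cycle_free_def by (metis append.assoc)

text \<open>If two heads agree, the piece after the first of these arcs up to the second is a
  shorter closed list; otherwise the list itself is a simple cycle, which is minimal.\<close>

lemma closed_not_cycle_free:
  assumes "p \<noteq> []" "linked p" "head H (last p) = tail H (hd p)"
  shows "\<not> cycle_free p"
  using assms
proof (induction "length p" arbitrary: p rule: less_induct)
  case less
  show ?case
  proof (cases "distinct (map (head H) p)")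
    case True
    then have "minimal_cycle H (set p)"
      using less.prems directed_cycle_iff by (auto intro!: directed_cycle_minimal)
    then show ?thesis unfolding cycle_free_def by (metis append_Nil append_Nil2)
  next
    case False
    then obtain a x b y c where p: "p = a @ x # b @ y # c" "head H x = head H y"
      by (rule not_distinct_map_decomp)
    have "linked (b @ [y])" "head H x = tail H (hd (b @ [y]))"
      using less.prems(2) unfolding p(1) by (auto simp: linked_append linked_Cons hd_append split: if_splits)
    then have "\<not> cycle_free (b @ [y])" using less.hyps[of "b @ [y]"] p by auto
    then show ?thesis using cycle_free_sublist[of "a @ [x]" "b @ [y]" c] p by auto
  qed
qed

lemma cycle_free_head_inj:
  assumes "linked p" "cycle_free p" "p = a @ x # b @ y # c"
  shows "head H x \<noteq> head H y"
proof
  assume eq: "head H x = head H y"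
  have "linked (b @ [y])" "head H x = tail H (hd (b @ [y]))"
    using assms(1) unfolding assms(3) by (auto simp: linked_append linked_Cons hd_append split: if_splits)
  then have "\<not> cycle_free (b @ [y])" using closed_not_cycle_free[of "b @ [y]"] eq by auto
  then show False using cycle_free_sublist[of "a @ [x]" "b @ [y]" c] assms(2,3) by auto
qed

lemma cycle_free_distinct_heads: "linked p \<Longrightarrow> cycle_free p \<Longrightarrow> distinct (map (head H) p)"
  using not_distinct_map_decomp[of "head H" p] cycle_free_head_inj by metis

lemma cycle_free_length: 
  assumes "linked p" "cycle_free p"
  shows "length p \<le> card (arcs H)"
proof -
  have "distinct p" using cycle_free_distinct_heads[OF assms] by (simp add: distinct_map)
  then have "length p = card (set p)" by (simp add: distinct_card)
  then show ?thesis using linked_arcs[OF assms(1)] by (simp add: card_mono)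
qed

lemma good_walk_iff:
  "good_walk H p \<longleftrightarrow> p \<noteq> [] \<and> linked p \<and> source H (tail H (hd p)) \<and> sink H (head H (last p)) \<and> cycle_free p"
proof -
  \<comment> \<open>Such a vertex would have degree sum 0 instead of 1; this excludes the empty
    walk.\<close>
  have "\<not> (source H v \<and> sink H v)" for v
    using source_degree[of v] unfolding source_def sink_def by linarith
  then have "source_sink_walk H p \<longleftrightarrow> p \<noteq> [] \<and> linked p \<and> source H (tail H (hd p)) \<and> sink H (head H (last p))"
    unfolding source_sink_walk_def
    by (cases "p = []") (auto simp: awalk_linked awalk_Nil_iff)
  then show ?thesis unfolding good_walk_def cycle_free_def by blast
qed

lemma finite_good_walks: "finite {p. good_walk H p}"
proof (rule finite_subset)
  show "{p. good_walk H p} \<subseteq> {p. set p \<subseteq> arcs H \<and> length p \<le> card (arcs H)}"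
    using good_walk_iff linked_arcs cycle_free_length by auto
  show "finite {p. set p \<subseteq> arcs H \<and> length p \<le> card (arcs H)}"
    by (rule finite_lists_length_le) simp
qed

end

section \<open>Initial segments of finite linear orders\<close>

text \<open>Through ranks an initial segment makes sense for any relation, so it can be used in the
  recursion \<open>sprout_step\<close> before the order properties are known.\<close>

definition seg :: "('x \<Rightarrow> 'x \<Rightarrow> bool) \<Rightarrow> nat \<Rightarrow> 'x set \<Rightarrow> 'x set" where
  "seg r k X = {x \<in> X. card {y \<in> X. r y x} < k}"

locale finite_order =
  fixes r :: "'x \<Rightarrow> 'x \<Rightarrow> bool" and X :: "'x set"
  assumes fin: "finite X"
    and irrefl: "x \<in> X \<Longrightarrow> \<not> r x x"
    and trans: "x \<in> X \<Longrightarrow> y \<in> X \<Longrightarrow> z \<in> X \<Longrightarrow> r x y \<Longrightarrow> r y z \<Longrightarrow> r x z"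
    and total: "x \<in> X \<Longrightarrow> y \<in> X \<Longrightarrow> x \<noteq> y \<Longrightarrow> r x y \<or> r y x"
begin

definition rank :: "'x \<Rightarrow> nat" where
  "rank x = card {y \<in> X. r y x}"

lemma rank_mono: "x \<in> X \<Longrightarrow> y \<in> X \<Longrightarrow> r x y \<Longrightarrow> rank x < rank y"
proof -
  assume xy: "x \<in> X" "y \<in> X" "r x y"
  have "{z \<in> X. r z x} \<subseteq> {z \<in> X. r z y}" using xy trans[of _ x y] by blast
  moreover have "x \<in> {z \<in> X. r z y}" "x \<notin> {z \<in> X. r z x}" using xy irrefl by auto
  ultimately show ?thesis unfolding rank_def using fin by (intro psubset_card_mono) auto
qed

lemma rank_bij: "bij_betw rank X {..<card X}"
proof -
  have inj: "inj_on rank X"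
    by (rule inj_onI) (metis less_irrefl rank_mono total)
  have "rank x < card X" if "x \<in> X" for x
    unfolding rank_def using fin irrefl that by (intro psubset_card_mono) auto
  then have "rank ` X \<subseteq> {..<card X}" by auto
  moreover have "card (rank ` X) = card X" using inj by (rule card_image)
  ultimately have "rank ` X = {..<card X}" by (simp add: card_subset_eq)
  then show ?thesis using inj by (simp add: bij_betw_def)
qed

lemma card_seg:
  assumes "k \<le> card X"
  shows "card (seg r k X) = k"
proof -
  have "rank ` seg r k X = {..<k}"
  proof
    show "rank ` seg r k X \<subseteq> {..<k}" by (auto simp: seg_def rank_def)
    show "{..<k} \<subseteq> rank ` seg r k X"
    proof
      fix i assume i: "i \<in> {..<k}"
      then have "i \<in> rank ` X" using rank_bij assms by (auto simp: bij_betw_def)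
      then show "i \<in> rank ` seg r k X" using i by (auto simp: seg_def rank_def)
    qed
  qed
  moreover have "inj_on rank (seg r k X)"
    using rank_bij by (auto simp: bij_betw_def seg_def intro: inj_on_subset)
  ultimately show ?thesis by (metis card_image card_lessThan)
qed

text \<open>Elements of \<open>Y\<close> have all their predecessors in \<open>Y\<close> and so rank
  below \<open>card Y\<close>, whereas all of \<open>Y\<close> precedes an element outside. That a
  down-closed set is fixed by its size is what allows reconstruction from numbers.\<close>

lemma seg_unique:
  assumes "Y \<subseteq> X" and down: "\<And>a x. a \<in> Y \<Longrightarrow> x \<in> X \<Longrightarrow> r x a \<Longrightarrow> x \<in> Y"
  shows "Y = seg r (card Y) X"
proof -
  have "finite Y" using assms(1) fin finite_subset by auto
  have "rank x < card Y" if "x \<in> Y" for x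
    unfolding rank_def using that assms \<open>finite Y\<close> irrefl by (intro psubset_card_mono) auto
  moreover have "\<not> rank x < card Y" if "x \<in> X" "x \<notin> Y" for x
  proof -
    have "Y \<subseteq> {y \<in> X. r y x}" using that assms total by blast
    then have "card Y \<le> rank x" unfolding rank_def using fin by (intro card_mono) auto
    then show ?thesis by simp
  qed
  ultimately show ?thesis using assms(1) unfolding seg_def rank_def by blast
qed

lemma seg_down: "a \<in> seg r k X \<Longrightarrow> x \<in> X \<Longrightarrow> r x a \<Longrightarrow> x \<in> seg r k X"
  using rank_mono[of x a] by (auto simp: seg_def rank_def)

lemma minimum:
  assumes "X \<noteq> {}"
  obtains x where "x \<in> X" "\<And>y. y \<in> X \<Longrightarrow> \<not> r y x"
proof -
  have "0 \<in> rank ` X" using rank_bij assms fin by (auto simp: bij_betw_def)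
  then obtain x where "x \<in> X" "rank x = 0" by auto
  then show thesis using that[of x] rank_mono by force
qed

text \<open>Since \<open>b\<close> precedes \<open>a\<close>, every element lies below
  \<open>a\<close> or above \<open>b\<close>. These counts are at most \<open>k - 1\<close> and
  \<open>l - 1\<close>, which gives the constant 2.\<close>

lemma seg_crossing:
  assumes "a \<in> seg r k X" "b \<in> seg (\<lambda>x y. r y x) l X" "r b a"
  shows "card X + 2 \<le> k + l"
proof -
  have ab: "a \<in> X" "b \<in> X" using assms by (auto simp: seg_def)
  have "X \<subseteq> {y \<in> X. r y a} \<union> {y \<in> X. r b y}"
    using total trans assms(3) ab by blast
  then have "card X \<le> card ({y \<in> X. r y a} \<union> {y \<in> X. r b y})"
    using fin by (intro card_mono) auto
  also have "\<dots> \<le> card {y \<in> X. r y a} + card {y \<in> X. r b y}" by (rule card_Un_le)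
  finally show ?thesis using assms(1,2) by (auto simp: seg_def)
qed

lemma seg_cover:
  assumes "card X \<le> k + l" "x \<in> X"
  shows "x \<in> seg r k X \<or> x \<in> seg (\<lambda>x y. r y x) l X"
proof -
  have "card ({y \<in> X. r y x} \<union> {y \<in> X. r x y}) < card X"
    using assms(2) irrefl fin by (intro psubset_card_mono) auto
  moreover have "{y \<in> X. r y x} \<inter> {y \<in> X. r x y} = {}"
    using assms(2) irrefl trans by blast
  ultimately have "card {y \<in> X. r y x} + card {y \<in> X. r x y} < card X"
    using fin by (simp add: card_Un_disjoint)
  then show ?thesis using assms by (auto simp: seg_def)
qed

end

section \<open>Prefixes of walks and their order\<close>

text \<open>Ordered by extension these prefixes form a forest. The empty list is excluded because a
  prefix is always located by its last arc.\<close>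

definition tree :: "'b list set \<Rightarrow> 'b list set" where
  "tree W = {a. a \<noteq> [] \<and> (\<exists>q. a @ q \<in> W)}"

lemma tree_prefix: "a @ q \<in> tree W \<Longrightarrow> a \<noteq> [] \<Longrightarrow> a \<in> tree W"
  by (auto simp: tree_def)

lemma tree_nonempty: "a \<in> tree W \<Longrightarrow> a \<noteq> []"
  by (simp add: tree_def)

lemma finite_tree: "finite W \<Longrightarrow> finite (tree W)"
proof (rule finite_subset)
  assume "finite W"
  then show "finite (\<Union>p \<in> W. (\<lambda>n. take n p) ` {..length p})" by blast
  have "a \<in> (\<Union>p \<in> W. (\<lambda>n. take n p) ` {..length p})" if "a @ q \<in> W" for a q
    by (rule UN_I[OF that], rule image_eqI[of _ _ "length a"]) auto
  then show "tree W \<subseteq> (\<Union>p \<in> W. (\<lambda>n. take n p) ` {..length p})"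
    by (auto simp: tree_def)
qed

definition walks :: "'b route set \<Rightarrow> 'b list set" where
  "walks K = {p. Walk p \<in> K}"

text \<open>Both lists are read from the end until they differ or one is used up. For walks from
  sources to the same vertex only the first case survives, by
  \<open>source_walks_suffix\<close>.\<close>

lemma common_suffix_cases:
  assumes "p \<noteq> q"
  obtains (diverge) P P' S where "p = P @ S" "q = P' @ S" "P \<noteq> []" "P' \<noteq> []" "last P \<noteq> last P'"
  | (left) P where "P \<noteq> []" "p = P @ q"
  | (right) P where "P \<noteq> []" "q = P @ p"
proof -
  have "(\<exists>P P' S. p = P @ S \<and> q = P' @ S \<and> P \<noteq> [] \<and> P' \<noteq> [] \<and> last P \<noteq> last P') \<or>
        (\<exists>P. P \<noteq> [] \<and> p = P @ q) \<or> (\<exists>P. P \<noteq> [] \<and> q = P @ p)"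
    using assms
  proof (induction p arbitrary: q rule: rev_induct)
    case (snoc x p)
    show ?case
    proof (cases q rule: rev_exhaust)
      case Nil
      then show ?thesis by auto
    next
      case (snoc q' y)
      show ?thesis
      proof (cases "x = y")
        case True
        then have "p \<noteq> q'" using snoc \<open>p @ [x] \<noteq> q\<close> by auto
        from snoc.IH[OF this] show ?thesis
        proof (elim disjE exE conjE)
          fix P P' S assume "p = P @ S" "q' = P' @ S" "P \<noteq> []" "P' \<noteq> []" "last P \<noteq> last P'"
          then have "p @ [x] = P @ (S @ [x]) \<and> q = P' @ (S @ [x]) \<and> P \<noteq> [] \<and> P' \<noteq> [] \<and> last P \<noteq> last P'"
            using \<open>q = q' @ [y]\<close> True by simp
          then show ?thesis by blast
        qed (use \<open>q = q' @ [y]\<close> True in auto)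
      next
        case False
        then have "p @ [x] = (p @ [x]) @ [] \<and> q = (q' @ [y]) @ [] \<and> last (p @ [x]) \<noteq> last (q' @ [y])"
          using snoc by auto
        then show ?thesis by (metis Nil_is_append_conv not_Cons_self2)
      qed
    qed
  qed auto
  then show thesis using diverge left right by blast
qed

context framed_graph
begin

abbreviation tip :: "'b list \<Rightarrow> 'a" where
  "tip a \<equiv> head H (last a)"

text \<open>\<open>S\<close> is the stretch after the last merge. The parameter \<open>c\<close> is
  the colour that counts as first; the order for the other colour is the converse, so each out-arc
  finds its own prefixes at the bottom of the order of its colour.\<close>

definition before :: "colour \<Rightarrow> 'b list \<Rightarrow> 'b list \<Rightarrow> bool" where
  "before c p q \<longleftrightarrow>
     (\<exists>P P' S. p = P @ S \<and> q = P' @ S \<and> P \<noteq> [] \<and> P' \<noteq> [] \<and> col (last P) = c \<and> col (last P') \<noteq> c)"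

lemma before_flip: 
  assumes "c \<noteq> c'"
  shows "before c' p q \<longleftrightarrow> before c q p"
  unfolding before_def using assms colour_neq[OF assms] colour_neq[OF assms[symmetric]] by metis

text \<open>The common last arc \<open>e\<close> must belong to \<open>S\<close>, since the two
  lists part at arcs of different colours.\<close>

lemma before_snocD:
  assumes "before c (p @ [e]) (q @ [e])"
  shows "before c p q"
proof -
  obtain P P' S where S: "p @ [e] = P @ S" "q @ [e] = P' @ S" "P \<noteq> []" "P' \<noteq> []"
    "col (last P) = c" "col (last P') \<noteq> c"
    using assms before_def by auto
  show ?thesis
  proof (cases S rule: rev_exhaust)
    case Nil
    then have "last P = e" "last P' = e" using S(1,2) by (metis append_Nil2 last_snoc)+
    then show ?thesis using S by simp
  next
    case (snoc S' x)
    then have "p = P @ S'" "q = P' @ S'" using S(1,2) by (metis append.assoc butlast_snoc)+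
    then show ?thesis using S before_def by blast
  qed
qed

lemma before_last: "p \<noteq> [] \<Longrightarrow> q \<noteq> [] \<Longrightarrow> col (last p) = c \<Longrightarrow> col (last q) \<noteq> c \<Longrightarrow> before c p q"
  unfolding before_def by (intro exI[of _ p] exI[of _ q] exI[of _ "[]"]) auto

definition colour_rel :: "colour \<Rightarrow> ('b \<times> 'b) set" where
  "colour_rel c = {(x, y). col x = c \<and> col y \<noteq> c}"

text \<open>Reversal turns the common suffix into a common prefix. Containment in a lexicographic
  order yields asymmetry and excludes 3-cycles without comparing the places where walks
  merge.\<close>

lemma before_lexord:
  assumes "before c p q"
  shows "(rev p, rev q) \<in> lexord (colour_rel c)"
proof -
  obtain P P' S where S: "p = P @ S" "q = P' @ S" "P \<noteq> []" "P' \<noteq> []"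
    "col (last P) = c" "col (last P') \<noteq> c"
    using assms before_def by auto
  have "P = butlast P @ [last P]" "P' = butlast P' @ [last P']" using S by auto
  then have "rev p = rev S @ last P # rev (butlast P)" "rev q = rev S @ last P' # rev (butlast P')"
    unfolding S(1,2) by (metis rev_append rev_eq_Cons_iff rev_rev_ident)+
  moreover have "(last P, last P') \<in> colour_rel c" using S by (simp add: colour_rel_def)
  ultimately show ?thesis by (simp add: lexord_append_left_rightI)
qed

lemma before_asym: "before c p q \<Longrightarrow> \<not> before c q p"
  and before_irrefl: "\<not> before c p p"
  and before_no_cycle: "before c p q \<Longrightarrow> before c q r \<Longrightarrow> \<not> before c r p"
  and before_neq: "before c p q \<Longrightarrow> before c q r \<Longrightarrow> p \<noteq> r"
proof -
  have tr: "trans (lexord (colour_rel c))"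
    by (rule lexord_transI) (auto simp: trans_def colour_rel_def)
  have irr: "(x, x) \<notin> lexord (colour_rel c)" for x
    by (rule lexord_irreflexive) (auto simp: colour_rel_def)
  show *: "before c p q \<Longrightarrow> \<not> before c q p" for p q
    using transD[OF tr before_lexord before_lexord] irr by blast
  show "\<not> before c p p" using irr before_lexord by blast
  show "before c p q \<Longrightarrow> before c q r \<Longrightarrow> \<not> before c r p"
    using transD[OF tr transD[OF tr before_lexord before_lexord] before_lexord] irr by blast
  show "before c p q \<Longrightarrow> before c q r \<Longrightarrow> p \<noteq> r" using * by blast
qed

definition source_walks :: "'a \<Rightarrow> 'b list set" where
  "source_walks v = {p. p \<noteq> [] \<and> linked p \<and> source H (tail H (hd p)) \<and> tip p = v}"

lemma source_walks_suffix:
  assumes "P @ q \<in> source_walks v" "q \<in> source_walks w"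
  shows "P = []"
proof (rule ccontr)
  assume P: "P \<noteq> []"
  then have "head H (last P) = tail H (hd q)" "last P \<in> arcs H"
    using assms linked_arcs[of P] by (auto simp: source_walks_def linked_append)
  then show False using assms(2) not_source_head[of "last P"] by (simp add: source_walks_def)
qed

text \<open>At the last merge two distinct arcs share their head, hence differ in colour. Neither
  walk is a proper suffix of the other, as such a suffix does not start at a source.\<close>

lemma before_total:
  assumes "p \<in> source_walks v" "q \<in> source_walks v" "p \<noteq> q"
  shows "before c p q \<or> before c q p"
  using \<open>p \<noteq> q\<close>
proof (cases rule: common_suffix_cases)
  case (diverge P P' S)
  have "head H (last P) = head H (last P')"
    using assms(1,2) diverge by (cases "S = []") (auto simp: source_walks_def linked_append)
  moreover have "last P \<in> arcs H" "last P' \<in> arcs H"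
    using assms(1,2) diverge(1-4) linked_arcs[of P] linked_arcs[of P']
    by (auto simp: source_walks_def linked_append)
  ultimately have "col (last P) \<noteq> col (last P')" using in_arc_eq diverge(5) by blast
  then have "col (last P) = c \<and> col (last P') \<noteq> c \<or> col (last P') = c \<and> col (last P) \<noteq> c"
    using colour_neq by blast
  then show ?thesis unfolding before_def using diverge by blast
qed (use assms source_walks_suffix in blast)+

text \<open>Comparability of \<open>p\<close> and \<open>r\<close> leaves equality and the reverse
  relation to exclude, and both contradict the lexicographic order.\<close>

lemma before_trans:
  assumes "p \<in> source_walks v" "r \<in> source_walks v" "before c p q" "before c q r"
  shows "before c p r"
  using before_total[OF assms(1,2)] before_no_cycle[OF assms(3,4)] before_neq[OF assms(3,4)] by blast

lemma finite_order_before: "finite X \<Longrightarrow> X \<subseteq> source_walks v \<Longrightarrow> finite_order (before c) X"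
proof
  assume X: "finite X" "X \<subseteq> source_walks v"
  show "\<not> before c x x" for x by (rule before_irrefl)
  show "before c x z" if "x \<in> X" "z \<in> X" "before c x y" "before c y z" for x y z
    using X that by (meson before_trans subsetD)
  show "before c x y \<or> before c y x" if "x \<in> X" "y \<in> X" "x \<noteq> y" for x y
    using X that by (meson before_total subsetD)
qed simp

lemma tree_source_walks:
  assumes "W \<subseteq> {p. good_walk H p}" "a \<in> tree W"
  shows "a \<in> source_walks (tip a)" "cycle_free a"
proof -
  obtain q where "a @ q \<in> W" "a \<noteq> []" using assms(2) by (auto simp: tree_def)
  then have "linked (a @ q)" "source H (tail H (hd a))" "cycle_free (a @ q)" "a \<noteq> []"
    using assms(1) by (auto simp: good_walk_iff subset_iff)
  then show "a \<in> source_walks (tip a)" "cycle_free a"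
    using cycle_free_sublist[of "[]" a q] by (auto simp: source_walks_def linked_append)
qed

lemma tree_snoc:
  assumes "W \<subseteq> {p. good_walk H p}" "a @ [e] \<in> tree W" "a \<noteq> []"
  shows "a \<in> tree W" "tip a = tail H e" "e \<in> arcs H"
  using tree_prefix[OF assms(2,3)] tree_source_walks(1)[OF assms(1,2)] assms(3)
  by (auto simp: source_walks_def linked_append)

lemma tree_extend:
  assumes "W \<subseteq> {p. good_walk H p}" "a \<in> tree W" "\<not> sink H (tip a)"
  shows "\<exists>e. a @ [e] \<in> tree W"
proof -
  obtain q where q: "a @ q \<in> W" "a \<noteq> []" using assms(2) by (auto simp: tree_def)
  then have "sink H (tip (a @ q))" using assms(1) good_walk_iff by blast
  then obtain e q' where "q = e # q'" using assms(3) by (cases q) auto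
  then show ?thesis using q by (auto simp: tree_def intro!: exI[of _ e] exI[of _ q'])
qed

section \<open>Cliques\<close>

lemma clique_good: "clique H col K \<Longrightarrow> p \<in> walks K \<Longrightarrow> good_walk H p"
  by (auto simp: clique_def walks_def Routes_def)

lemma clique_good_walks: "clique H col K \<Longrightarrow> walks K \<subseteq> {p. good_walk H p}"
  using clique_good by auto

lemma finite_clique_tree: "clique H col K \<Longrightarrow> finite (tree (walks K))"
  by (rule finite_tree, rule finite_subset[OF _ finite_good_walks]) (auto dest: clique_good)

text \<open>Compatibility rephrased for prefixes instead of whole walks;
  \<open>clique_noncrossing\<close> and \<open>noncrossing_not_crossing\<close> link the two. Having
  two arguments allows a single new walk to be tested against a clique.\<close>

definition noncrossing :: "'b list set \<Rightarrow> 'b list set \<Rightarrow> bool" where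
  "noncrossing W W' \<longleftrightarrow>
     (\<forall>a e b e'. a \<noteq> [] \<and> b \<noteq> [] \<and> a @ [e] \<in> tree W \<and> b @ [e'] \<in> tree W' \<and> tip a = tip b \<and> e \<noteq> e'
        \<longrightarrow> \<not> before (col e) b a)"

lemma noncrossingD:
  "noncrossing W W' \<Longrightarrow> a @ [e] \<in> tree W \<Longrightarrow> b @ [e'] \<in> tree W' \<Longrightarrow> a \<noteq> [] \<Longrightarrow> b \<noteq> [] \<Longrightarrow>
     tip a = tip b \<Longrightarrow> e \<noteq> e' \<Longrightarrow> \<not> before (col e) b a"
  by (auto simp: noncrossing_def)

text \<open>A second visit to a vertex would close a cycle, so the tip determines the position in
  the walk.\<close>

lemma cycle_free_prefix_eq:
  assumes "linked p" "cycle_free p" "p = a @ q" "p = b @ q'" "a \<noteq> []" "b \<noteq> []" "tip a = tip b"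
  shows "a = b"
proof (rule ccontr)
  have neq: "tip (x @ u) \<noteq> tip x" if "p = x @ u @ r" "x \<noteq> []" "u \<noteq> []" for x u r
  proof -
    have "p = butlast x @ last x # butlast u @ last u # r" using that by simp
    from cycle_free_head_inj[OF assms(1,2) this] show ?thesis using that by simp
  qed
  assume "a \<noteq> b"
  obtain u where "a = b @ u \<and> u @ q = q' \<or> a @ u = b \<and> q = u @ q'"
    using assms(3,4) by (metis append_eq_append_conv2)
  then show False
  proof
    assume *: "a = b @ u \<and> u @ q = q'"
    then have "u \<noteq> []" using \<open>a \<noteq> b\<close> by auto
    then show False using neq[of b u q] * assms(3,6,7) by simp
  next
    assume *: "a @ u = b \<and> q = u @ q'"
    then have "u \<noteq> []" using \<open>a \<noteq> b\<close> by auto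
    then show False using neq[of a u q'] * assms(3,5,7) by simp
  qed
qed

lemma clique_noncrossing:
  assumes K: "clique H col K"
  shows "noncrossing (walks K) (walks K)"
  unfolding noncrossing_def
proof (intro allI impI notI, elim conjE)
  fix a e b e'
  assume ne: "a \<noteq> []" "b \<noteq> []" and T: "a @ [e] \<in> tree (walks K)" "b @ [e'] \<in> tree (walks K)"
    and tip: "tip a = tip b" "e \<noteq> e'" and bef: "before (col e) b a"
  obtain q q' where q: "(a @ [e]) @ q \<in> walks K" "(b @ [e']) @ q' \<in> walks K"
    using T unfolding tree_def by blast
  note good = clique_good_walks[OF K]
  have "col e \<noteq> col e'"
    using tree_snoc[OF good T(1) ne(1)] tree_snoc[OF good T(2) ne(2)] tip out_arc_eq[of e e'] by auto
  obtain P P' S where S: "b = P @ S" "a = P' @ S" "P \<noteq> []" "P' \<noteq> []"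
    "col (last P) = col e" "col (last P') \<noteq> col e"
    using bef before_def by auto
  have h: "head H (last P) = head H (last P')"
    using tip(1) tree_source_walks(1)[OF good T(1)] tree_source_walks(1)[OF good T(2)] S
    by (cases "S = []") (auto simp: source_walks_def linked_append)
  let ?p = "(a @ [e]) @ q" and ?p' = "(b @ [e']) @ q'"
  \<comment> \<open>\<open>pairwise\<close> says nothing about a route and itself. Equal walks would
    force \<open>a = b\<close>, but \<open>before\<close> is irreflexive.\<close>
  have ne: "?p \<noteq> ?p'"
  proof
    assume eq: "?p = ?p'"
    have "a = b"
      by (rule cycle_free_prefix_eq[of ?p a "e # q" b "e' # q'"])
         (use clique_good[OF K q(1)] eq ne tip in \<open>auto simp: good_walk_iff\<close>)
    then show False using bef before_irrefl by simp
  qed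
  have dec: "?p = P' @ S @ (e # q)" "?p' = P @ S @ (e' # q')" using S by auto
  have "crossing H col ?p ?p' \<or> crossing H col ?p' ?p"
  proof (cases "col e")
    case Red
    then have "col e' = Blue" "col (last P') = Blue" "col (last P) = Red"
      using \<open>col e \<noteq> col e'\<close> S by (metis colour.exhaust)+
    then have "crossing H col ?p ?p'"
      unfolding crossing_def using dec S h Red
      by (intro exI[of _ P'] exI[of _ S] exI[of _ "e # q"] exI[of _ P] exI[of _ "e' # q'"]) auto
    then show ?thesis by simp
  next
    case Blue
    then have "col e' = Red" "col (last P') = Red" "col (last P) = Blue"
      using \<open>col e \<noteq> col e'\<close> S by (metis colour.exhaust)+
    then have "crossing H col ?p' ?p"
      unfolding crossing_def using dec S h Blue
      by (intro exI[of _ P] exI[of _ S] exI[of _ "e' # q'"] exI[of _ P'] exI[of _ "e # q"]) auto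
    then show ?thesis by simp
  qed
  moreover have "Walk ?p \<in> K" "Walk ?p' \<in> K" "Walk ?p \<noteq> Walk ?p'"
    using q ne unfolding walks_def by blast+
  ultimately show False using K unfolding clique_def pairwise_def by (metis incompatible.simps(1))
qed

lemma noncrossing_not_crossing:
  assumes "noncrossing {p} {p'}" "linked p" "linked p'"
  shows "\<not> crossing H col p p'" "\<not> crossing H col p' p"
proof -
  have tip: "tip (P @ S) = tip (P' @ S)" if "head H (last P) = head H (last P')" for P P' S :: "'b list"
    using that by (cases "S = []") auto
  have tree: "(P @ S) @ [hd Q] \<in> tree {x}" if "x = P @ S @ Q" "Q \<noteq> []" for P S Q x :: "'b list"
    using that by (cases Q) (auto simp: tree_def)
  show "\<not> crossing H col p p'"
  proof
    assume "crossing H col p p'"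
    then obtain P S Q P' Q' where *: "p = P @ S @ Q" "p' = P' @ S @ Q'"
       "P \<noteq> []" "Q \<noteq> []" "P' \<noteq> []" "Q' \<noteq> []" "head H (last P) = head H (last P')"
       "col (last P) = Blue" "col (hd Q') = Blue" "col (hd Q) = Red" "col (last P') = Red"
      unfolding crossing_def by blast
    have hd_neq: "hd Q \<noteq> hd Q'" using * by (metis colour.distinct(1))
    have "\<not> before (col (hd Q)) (P' @ S) (P @ S)"
      by (rule noncrossingD[OF assms(1) tree[OF *(1,4)] tree[OF *(2,6)]])
        (use * tip[of P P' S] hd_neq in simp_all)
    moreover have "before Red (P' @ S) (P @ S)"
      unfolding before_def using * by (intro exI[of _ P] exI[of _ S] exI[of _ P']) auto
    ultimately show False using * by simp
  qed
  show "\<not> crossing H col p' p"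
  proof
    assume "crossing H col p' p"
    then obtain P S Q P' Q' where *: "p' = P @ S @ Q" "p = P' @ S @ Q'"
       "P \<noteq> []" "Q \<noteq> []" "P' \<noteq> []" "Q' \<noteq> []" "head H (last P) = head H (last P')"
       "col (last P) = Blue" "col (hd Q') = Blue" "col (hd Q) = Red" "col (last P') = Red"
      unfolding crossing_def by blast
    have hd_neq: "hd Q \<noteq> hd Q'" using * by (metis colour.distinct(1))
    \<comment> \<open>The roles are exchanged, but the prefix of \<open>p\<close> must again come
      first in \<open>noncrossing\<close>; its continuing arc is now blue, so the blue order is
      used.\<close>
    have "\<not> before (col (hd Q')) (P @ S) (P' @ S)"
      by (rule noncrossingD[OF assms(1) tree[OF *(2,6)] tree[OF *(1,4)]])
        (use * tip[of P P' S] hd_neq in simp_all)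
    moreover have "before Blue (P @ S) (P' @ S)"
      unfolding before_def using * by (intro exI[of _ P] exI[of _ S] exI[of _ P']) auto
    ultimately show False using * by simp
  qed
qed

text \<open>Let \<open>c\<close> be the colour of the cycle. In the order of \<open>c\<close>,
  prefixes arriving along the cycle precede those arriving by the other in-arc, and those leaving
  along the cycle come first. If every arc were used, a \<open>c\<close>-first prefix would
  therefore make a full turn.\<close>

lemma clique_cycle_unused_arc:
  assumes K: "clique H col K" and C: "minimal_cycle H C"
  shows "\<exists>e \<in> C. \<forall>a \<in> tree (walks K). last a \<noteq> e"
proof (rule ccontr)
  assume "\<not> ?thesis"
  then have used: "\<exists>a \<in> tree (walks K). last a = e" if "e \<in> C" for e using that by blast
  let ?T = "tree (walks K)"
  note good = clique_good_walks[OF K]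
  obtain e0 where e0: "e0 \<in> C" using C minimal_cycle_directed directed_cycle_nonempty by blast
  obtain p where p: "p \<noteq> []" "linked p" "hd p = e0" "C = set p"
    using cycle_listE[OF minimal_cycle_directed[OF C] e0] by metis
  define c where "c = col e0"
  have c: "col e = c" if "e \<in> C" for e using minimal_cycle_colour[OF C that e0] c_def by simp
  let ?X = "{a \<in> ?T. last a = e0}"
  have "finite_order (before c) ?X"
    using finite_clique_tree[OF K] tree_source_walks(1)[OF good]
    by (intro finite_order_before[of _ "head H e0"]) auto
  moreover have "?X \<noteq> {}" using used[OF e0] by auto
  ultimately obtain x0 where x0: "x0 \<in> ?X" "\<And>y. y \<in> ?X \<Longrightarrow> \<not> before c y x0"
    using finite_order.minimum[of "before c" ?X] by (metis (no_types, lifting))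
  \<comment> \<open>The invariant keeps the followed prefix \<open>c\<close>-first among all
    prefixes with the same last arc; this is what forces its next arc.\<close>
  have "x0 @ r \<in> ?T \<and> (\<forall>y \<in> ?T. last y = last (x0 @ r) \<longrightarrow> \<not> before c y (x0 @ r))"
    if "p = e0 # r @ s" for r s
    using that
  proof (induction r arbitrary: s rule: rev_induct)
    case Nil
    then show ?case using x0 by auto
  next
    case (snoc e' r)
    define x where "x = x0 @ r"
    define e where "e = last x"
    have x: "x \<in> ?T" "\<And>y. y \<in> ?T \<Longrightarrow> last y = e \<Longrightarrow> \<not> before c y x"
      using snoc.IH[of "e' # s"] snoc.prems by (auto simp: x_def e_def)
    have xne: "x \<noteq> []" using x tree_nonempty by blast
    have last: "e = last (e0 # r)" using x0 tree_nonempty by (auto simp: x_def e_def)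
    have eC: "e \<in> C" "e' \<in> C" using last p(4) snoc.prems by auto
    have ee: "head H e = tail H e'"
      using p(2) last unfolding snoc.prems by (auto simp: linked_append linked_Cons split: if_splits)
    note e' = minimal_cycle_arcs[OF C eC(2)]
    obtain y where y: "y @ [e'] \<in> ?T"
      using used[OF eC(2)] tree_nonempty by (metis append_butlast_last_id)
    have "y \<noteq> []"
    proof
      assume "y = []"
      then have "source H (tail H e')" using tree_source_walks(1)[OF good y] by (simp add: source_walks_def)
      then show False using minimal_cycle_internal[OF C eC(2)] internal_not_source by blast
    qed
    note y' = tree_snoc[OF good y this]
    have xe': "x @ [e'] \<in> ?T"
    proof (cases "x = y")
      case False
      have tips: "tip x = tip y" using y'(2) ee by (simp add: e_def)
      have "\<not> sink H (tip x)"
        using minimal_cycle_internal[OF C eC(1)] internal_not_sink by (auto simp: e_def)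
      then obtain g where g: "x @ [g] \<in> ?T" using tree_extend[OF good x(1)] by blast
      have "g = e'"
      proof (rule ccontr)
        \<comment> \<open>Then \<open>y\<close>, which takes \<open>e'\<close>, has to precede
          \<open>x\<close>. By the choice of \<open>x\<close> it does not end with \<open>e\<close>,
          so it enters by the arc of the other colour, and this puts it after
          \<open>x\<close>.\<close>
        assume "g \<noteq> e'"
        then have "\<not> before (col e') x y"
          using noncrossingD[OF clique_noncrossing[OF K] y g] xne \<open>y \<noteq> []\<close> tips by auto
        then have nb: "\<not> before c x y" using c[OF eC(2)] by simp
        then have "before c y x"
          using before_total[of x "tip x" y c] False tips tree_source_walks(1)[OF good x(1)]
            tree_source_walks(1)[OF good y'(1)] by auto
        then have "last y \<noteq> e" using x(2)[OF y'(1)] by blast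
        moreover have "last y \<in> arcs H" 
          using tree_source_walks(1)[OF good y'(1)] linked_arcs[of y] \<open>y \<noteq> []\<close>
          by (auto simp: source_walks_def)
        ultimately have "col (last y) \<noteq> c"
          using in_arc_eq[of "last y" e] minimal_cycle_arcs[OF C eC(1)] c[OF eC(1)] ee y'(2) by auto
        then have "before c x y"
          using before_last[of x y c] xne \<open>y \<noteq> []\<close> c[OF eC(1)] by (simp add: e_def)
        then show False using nb by simp
      qed
      then show ?thesis using g by simp
    qed (use y in simp)
    moreover have "\<not> before c z (x @ [e'])" if z: "z \<in> ?T" "last z = e'" for z
    proof
      assume bz: "before c z (x @ [e'])"
      obtain z' where z': "z = z' @ [e']" using z tree_nonempty by (metis append_butlast_last_id)
      have zx: "before c z' x" using before_snocD bz z' by blast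
      then have "z' \<noteq> []" by (auto simp: before_def)
      note z'T = tree_snoc[OF good z(1)[unfolded z'] this]
      have "last z' \<noteq> e" using x(2)[OF z'T(1)] zx by blast
      moreover have "last z' \<in> arcs H" 
        using tree_source_walks(1)[OF good z'T(1)] linked_arcs[of z'] \<open>z' \<noteq> []\<close>
        by (auto simp: source_walks_def)
      ultimately have "col (last z') \<noteq> c"
        using in_arc_eq[of "last z'" e] minimal_cycle_arcs[OF C eC(1)] c[OF eC(1)] ee z'T(2) by auto
      then have "before c x z'"
        using before_last[of x z' c] xne \<open>z' \<noteq> []\<close> c[OF eC(1)] by (simp add: e_def)
      then show False using zx before_asym by blast
    qed
    ultimately show ?case using snoc.prems by (auto simp: x_def)
  qed
  from this[of "tl p" "[]"] have "x0 @ tl p \<in> ?T" using p by (cases p) auto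
  then have "cycle_free (x0 @ tl p)" using tree_source_walks(2)[OF good] by blast
  \<comment> \<open>The last arc of \<open>x0\<close> is the first arc of \<open>p\<close>, so the
    whole cycle appears consecutively.\<close>
  moreover have "x0 @ tl p = butlast x0 @ p @ []"
    using x0(1) p tree_nonempty[of x0] by (cases p; cases x0 rule: rev_cases) auto
  ultimately show False using C p(4) unfolding cycle_free_def by blast
qed

section \<open>Cutting the minimal cycles\<close>

lemma minimal_cycle_vertices:
  assumes "minimal_cycle H C"
  shows "head H ` C = tail H ` C"
proof -
  note C = minimal_cycle_directed[OF assms]
  have "\<exists>e' \<in> C. tail H e' = head H e" "\<exists>e' \<in> C. head H e' = tail H e" if "e \<in> C" for e
    using directed_cycle_succ[OF C that] directed_cycle_pred[OF C that] by auto
  then show ?thesis by (auto simp: image_iff) metis+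
qed

text \<open>A vertex and a colour determine the out-arc. Hence at most two minimal cycles, of
  opposite colours, pass through a vertex.\<close>

lemma minimal_cycle_eq_if_vertex_colour:
  assumes "minimal_cycle H C" "minimal_cycle H D" "v \<in> tail H ` C" "v \<in> tail H ` D"
    and "e \<in> C" "d \<in> D" "col e = col d"
  shows "C = D"
proof -
  obtain a b where ab: "a \<in> C" "tail H a = v" "b \<in> D" "tail H b = v" using assms by auto
  have "col a = col b"
    using minimal_cycle_colour[OF assms(1) ab(1) assms(5)] minimal_cycle_colour[OF assms(2) ab(3) assms(6)]
      assms(7) by simp
  then have "a = b"
    using out_arc_eq[of a b] minimal_cycle_arcs[OF assms(1) ab(1)] minimal_cycle_arcs[OF assms(2) ab(3)] ab
    by simp
  then show ?thesis using minimal_cycle_eq[OF assms(1,2) ab(1)] ab by simp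
qed

lemma loop_cycle:
  assumes "minimal_cycle H C" "e \<in> C" "head H e = tail H e"
  shows "C = {e}"
proof -
  have "e \<in> arcs H" using minimal_cycle_arcs assms by blast
  then have "directed_cycle H {e}"
    unfolding directed_cycle_iff using assms(3) by (intro exI[of _ "[e]"]) auto
  then show ?thesis using directed_cycle_minimal minimal_cycle_eq[OF assms(1) _ assms(2)] by blast
qed

text \<open>This is where the loop condition enters. Two loops at a vertex fill its in-arcs and its
  out-arcs, so cutting both strands no uncut arc.\<close>

lemma loop_vertex_cycle:
  assumes "minimal_cycle H C" "e \<in> arcs H" "head H e = tail H e" "tail H e \<in> tail H ` C"
  obtains d where "C = {d}" "head H d = tail H d"
proof -
  have "card C = 1"
    using loops assms unfolding loops_avoid_longer_cycles_def by metis
  then obtain d where "C = {d}" by (rule card_1_singletonE)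
  moreover then have "head H d = tail H d"
    using directed_cycle_pred[OF minimal_cycle_directed[OF assms(1)], of d] by auto
  ultimately show thesis using that by blast
qed

text \<open>A minimal cycle inside \<open>p @ c\<close> could lie in \<open>p\<close>, or in
  \<open>c\<close> and so properly in \<open>C\<close>, or contain both arcs next to the seam. The
  latter differ in colour, while minimal cycles are monochromatic.\<close>

lemma cycle_free_append:
  assumes "cycle_free p" "linked c" "minimal_cycle H C" "set c \<subset> C"
    and colours: "p \<noteq> [] \<Longrightarrow> c \<noteq> [] \<Longrightarrow> col (last p) \<noteq> col (hd c)"
  shows "cycle_free (p @ c)"
  unfolding cycle_free_def
proof (intro notI, elim exE conjE)
  fix xs ys zs
  assume eq: "p @ c = xs @ ys @ zs" and ys: "minimal_cycle H (set ys)"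
  have len: "length p + length c = length xs + length ys + length zs"
    using arg_cong[OF eq, of length] by simp
  consider "length xs + length ys \<le> length p" | "length p \<le> length xs"
    | "length xs < length p" "length p < length xs + length ys" by linarith
  then show False
  proof cases
    case 1
    then have "p = xs @ ys @ take (length p - length xs - length ys) zs"
      using arg_cong[OF eq, of "take (length p)"] by simp
    then show False using assms(1) ys cycle_free_def by blast
  next
    case 2
    then have "c = drop (length p) xs @ ys @ zs"
      using arg_cong[OF eq, of "drop (length p)"] by simp
    then have "set ys \<subseteq> set c" by auto
    then have "set ys \<subset> C" using assms(4) by blast
    then show False using assms(3) ys by (auto simp: minimal_cycle_def)
  next
    case 3
    have "(p @ c) ! (length p - 1) = last p" using 3 by (cases p rule: rev_cases) (auto simp: nth_append)
    moreover have "(xs @ ys @ zs) ! (length p - 1) = ys ! (length p - 1 - length xs)"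
      using 3 by (auto simp: nth_append)
    moreover have "(p @ c) ! length p = hd c" "c \<noteq> []"
      using 3 len by (cases c; auto simp: nth_append)+
    moreover have "(xs @ ys @ zs) ! length p = ys ! (length p - length xs)"
      using 3 by (auto simp: nth_append)
    moreover have "ys ! (length p - 1 - length xs) \<in> set ys" "ys ! (length p - length xs) \<in> set ys"
      using 3 by (auto intro!: nth_mem)
    ultimately have "last p \<in> set ys" "hd c \<in> set ys" "c \<noteq> []" using eq by simp_all
    moreover have "p \<noteq> []" using 3 by auto
    ultimately show False using colours minimal_cycle_colour[OF ys] by metis
  qed
qed

text \<open>
  The incidence graph of a family of minimal cycles and their common vertices is a forest: if every
  cycle met the others in two vertices, one could walk on forever, turning into another cycle at
  each meeting point, without completing a cycle.
\<close>

lemma leaf_cycle: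
  assumes S: "S \<noteq> {}" "\<And>C. C \<in> S \<Longrightarrow> minimal_cycle H C"
  shows "\<exists>C \<in> S. \<exists>v. \<forall>D \<in> S - {C}. tail H ` C \<inter> tail H ` D \<subseteq> {v}"
proof (rule ccontr)
  assume no_leaf: "\<not> ?thesis"
  have step: "\<exists>D \<in> S - {C}. \<exists>w. w \<in> tail H ` C \<inter> tail H ` D \<and> w \<noteq> v" if "C \<in> S" for C v
  proof (rule ccontr)
    assume none: "\<not> ?thesis"
    have "tail H ` C \<inter> tail H ` D \<subseteq> {v}" if "D \<in> S - {C}" for D
      using none that by (metis subsetI singletonI)
    then show False using no_leaf that by (metis (no_types, lifting))
  qed
  \<comment> \<open>The list grows from cycle to cycle: it ends at a vertex of the current cycle
    \<open>C\<close>, and its last arc has the other colour. The colour clause makes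
    \<open>cycle_free_append\<close> applicable at the next turn; the length eventually exceeds the
    number of arcs.\<close>
  have "\<exists>p C v. linked p \<and> cycle_free p \<and> n \<le> length p \<and> C \<in> S \<and> v \<in> tail H ` C \<and>
          (p \<noteq> [] \<longrightarrow> tip p = v \<and> (\<forall>e \<in> C. col e \<noteq> col (last p)))" for n
  proof (induction n)
    case 0
    obtain C where C: "C \<in> S" using S by auto
    then obtain v where "v \<in> tail H ` C"
      using S(2) minimal_cycle_directed directed_cycle_nonempty by fastforce
    moreover have "cycle_free []"
      using directed_cycle_nonempty minimal_cycle_directed unfolding cycle_free_def by force
    ultimately show ?case using C by (intro exI[of _ "[]"]) auto
  next
    case (Suc n)
    then obtain p C v where p: "linked p" "cycle_free p" "n \<le> length p" "C \<in> S" "v \<in> tail H ` C"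
      "p \<noteq> [] \<longrightarrow> tip p = v \<and> (\<forall>e \<in> C. col e \<noteq> col (last p))" by blast
    note C = S(2)[OF p(4)]
    obtain D w where D: "D \<in> S" "D \<noteq> C" "w \<in> tail H ` C" "w \<in> tail H ` D" "w \<noteq> v"
      using step[OF p(4)] by blast
    obtain e where e: "e \<in> C" "tail H e = v" using p(5) by auto
    obtain c where c: "linked c" "hd c = e" "distinct c" "C = set c"
      using cycle_listE[OF minimal_cycle_directed[OF C] e(1)] by metis
    obtain f where f: "f \<in> C" "tail H f = w" using D(3) by auto
    obtain c1 c2 where c12: "c = c1 @ f # c2" using f(1) c(4) by (metis split_list)
    have c1: "c1 \<noteq> []" using c12 c(2) e f D(5) by auto
    have c1l: "linked c1" "tip c1 = w" "hd c1 = e" using c c12 c1 f by (auto simp: linked_append linked_Cons)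
    have "set c1 \<subset> C" using c(3,4) c12 by auto
    have colD: "\<forall>d \<in> D. col d \<noteq> col e'" if "e' \<in> C" for e'
      using minimal_cycle_eq_if_vertex_colour[OF C S(2)[OF D(1)] D(3,4) that] D(2) by metis
    have "linked (p @ c1)"
      using p(1,6) c1l c1 e(2) by (auto simp: linked_append)
    moreover have "cycle_free (p @ c1)"
      by (rule cycle_free_append[OF p(2) c1l(1) C \<open>set c1 \<subset> C\<close>]) (use p(6) c1l e(1) in force)
    moreover have "Suc n \<le> length (p @ c1)" using p(3) c1 by (cases c1) auto
    moreover have "tip (p @ c1) = w" using c1 c1l by simp
    moreover have "\<forall>d \<in> D. col d \<noteq> col (last (p @ c1))"
    proof -
      have "last c1 \<in> C" using last_in_set[OF c1] \<open>set c1 \<subset> C\<close> by blast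
      then show ?thesis using colD c1 by auto
    qed
    ultimately show ?case using D(1,4) by blast
  qed
  from this[of "Suc (card (arcs H))"] show False
    using cycle_free_length by (meson Suc_n_not_le_n le_trans)
qed

lemma other_in_arc:
  assumes "internal H v" "i \<in> in_arcs H v" "i' \<in> in_arcs H v" "i \<noteq> i'"
  shows "in_arcs H v = {i, i'}"
  using in_arcs_pair[OF assms(1)] assms(2-4) by (smt (verit) doubleton_eq_iff insert_iff singletonD)

lemma other_out_arc:
  assumes "internal H v" "i \<in> out_arcs H v" "i' \<in> out_arcs H v" "i \<noteq> i'"
  shows "out_arcs H v = {i, i'}"
  using out_arcs_pair[OF assms(1,2)] assms(3,4) by (metis insert_iff singletonD)

lemma conflict_free_selection:
  assumes "finite S"
    and cyc: "\<And>C. C \<in> S \<Longrightarrow> minimal_cycle H C"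
    and noloop: "\<And>C e. C \<in> S \<Longrightarrow> e \<in> C \<Longrightarrow> head H e \<noteq> tail H e"
    and meets: "\<And>C. C \<in> S \<Longrightarrow> C \<inter> A \<noteq> {}"
    and balanced: "\<And>v. internal H v \<Longrightarrow> in_arcs H v \<subseteq> A \<longleftrightarrow> out_arcs H v \<subseteq> A"
  shows "\<exists>z. (\<forall>C \<in> S. z C \<in> C \<inter> A) \<and>
     (\<forall>C \<in> S. \<forall>D \<in> S. C \<noteq> D \<longrightarrow> head H (z C) \<noteq> head H (z D) \<and> tail H (z C) \<noteq> tail H (z D))"
  using assms(1-4)
proof (induction "card S" arbitrary: S)
  case 0
  then show ?case by auto
next
  case (Suc n)
  then have "S \<noteq> {}" by auto
  obtain C v where C: "C \<in> S" and v: "\<And>D. D \<in> S - {C} \<Longrightarrow> tail H ` C \<inter> tail H ` D \<subseteq> {v}"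
    using leaf_cycle[OF \<open>S \<noteq> {}\<close> Suc.prems(2)] by metis
  define S' where "S' = S - {C}"
  have "n = card S'" using Suc C by (simp add: S'_def)
  have "\<exists>z. (\<forall>C \<in> S'. z C \<in> C \<inter> A) \<and>
     (\<forall>C \<in> S'. \<forall>D \<in> S'. C \<noteq> D \<longrightarrow> head H (z C) \<noteq> head H (z D) \<and> tail H (z C) \<noteq> tail H (z D))"
    by (rule Suc.hyps(1)[OF \<open>n = card S'\<close>]) (use Suc.prems in \<open>auto simp: S'_def\<close>)
  then obtain z where z: "\<And>D. D \<in> S' \<Longrightarrow> z D \<in> D \<inter> A"
    "\<And>D E. D \<in> S' \<Longrightarrow> E \<in> S' \<Longrightarrow> D \<noteq> E \<Longrightarrow> head H (z D) \<noteq> head H (z E) \<and> tail H (z D) \<noteq> tail H (z E)"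
    by (metis (no_types, lifting))
  note mC = Suc.prems(2)[OF C]
  have mS': "minimal_cycle H D" "D \<in> S" "D \<noteq> C" if "D \<in> S'" for D
    using that Suc.prems(2) by (auto simp: S'_def)
  have headC: "head H e \<in> tail H ` D" if "minimal_cycle H D" "e \<in> D" for e D
    using minimal_cycle_vertices that by blast
  have shared: "head H e = head H (z D) \<Longrightarrow> head H e = v" "tail H e = tail H (z D) \<Longrightarrow> tail H e = v"
    if "e \<in> C" "D \<in> S'" for e D
    using v[of D] that z(1)[OF that(2)] headC[OF mC that(1)] headC[OF mS'(1)[OF that(2)], of "z D"]
    by (auto simp: S'_def)
  have "\<exists>e \<in> C \<inter> A. \<forall>D \<in> S'. head H e \<noteq> head H (z D) \<and> tail H e \<noteq> tail H (z D)"
  proof (cases "\<exists>D \<in> S'. v \<in> tail H ` C \<inter> tail H ` D")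
    case False
    obtain e where e: "e \<in> C \<inter> A" using Suc.prems(4)[OF C] by auto
    have "head H e \<noteq> head H (z D) \<and> tail H e \<noteq> tail H (z D)" if "D \<in> S'" for D
    proof (rule ccontr)
      assume "\<not> ?thesis"
      then consider "head H e = head H (z D)" | "tail H e = tail H (z D)" by blast
      then have "v \<in> tail H ` C \<inter> tail H ` D"
      proof cases
        case 1
        then have "head H e = v" using shared(1)[OF _ that] e by blast
        then show ?thesis using 1 headC[OF mC, of e] headC[OF mS'(1)[OF that], of "z D"] e z(1)[OF that] by auto
      next
        case 2
        then have "tail H e = v" using shared(2)[OF _ that] e by blast
        moreover have "tail H e \<in> tail H ` C" "tail H (z D) \<in> tail H ` D" using e z(1)[OF that] by auto
        ultimately show ?thesis using 2 by simp
      qed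
      then show False using False that by blast
    qed
    then show ?thesis using e by blast
  next
    case True
    then obtain D where D: "D \<in> S'" "v \<in> tail H ` C" "v \<in> tail H ` D" by blast
    \<comment> \<open>Only two colours are available at \<open>v\<close>, and \<open>C\<close> takes
      one of them.\<close>
    have uniq: "E = D" if E: "E \<in> S'" "v \<in> tail H ` E" for E
    proof -
      obtain c d e where cde: "c \<in> C" "d \<in> D" "e \<in> E" using D(2,3) E(2) by auto
      have "col c \<noteq> col d" "col c \<noteq> col e"
        using minimal_cycle_eq_if_vertex_colour[OF mC mS'(1)[OF D(1)] D(2,3) cde(1,2)]
          minimal_cycle_eq_if_vertex_colour[OF mC mS'(1)[OF E(1)] D(2) E(2) cde(1,3)]
          mS'(3)[OF D(1)] mS'(3)[OF E(1)] by auto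
      then have "col e = col d" using colour_neq by metis
      then show ?thesis
        using minimal_cycle_eq_if_vertex_colour[OF mS'(1)[OF E(1)] mS'(1)[OF D(1)] E(2) D(3) cde(3,2)]
        by simp
    qed
    have int: "internal H v" using D(2) minimal_cycle_internal[OF mC] by auto
    obtain out where out: "out \<in> C" "tail H out = v" using D(2) by auto
    obtain inn where inn: "inn \<in> C" "head H inn = v" using D(2) minimal_cycle_vertices[OF mC] by (metis imageE)
    have arc: "e \<in> arcs H" if "e \<in> C \<or> e \<in> D" for e
      using that minimal_cycle_arcs[OF mC] minimal_cycle_arcs[OF mS'(1)[OF D(1)]] by blast
    have zE: "head H (z E) = v \<Longrightarrow> E = D" "tail H (z E) = v \<Longrightarrow> E = D" if "E \<in> S'" for E
      using uniq[OF that] z(1)[OF that] headC[OF mS'(1)[OF that], of "z E"] by auto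
    have disj: "e \<noteq> z D" if "e \<in> C" for e
      using minimal_cycle_eq[OF mC mS'(1)[OF D(1)] that] z(1)[OF D(1)] mS'(3)[OF D(1)] by auto
    show ?thesis
    proof (cases "in_arcs H v \<subseteq> A")
      case True
      then have "out_arcs H v \<subseteq> A" using balanced[OF int] by simp
      then have A: "out \<in> A" "inn \<in> A" using True inn out arc by auto
      \<comment> \<open>If the cut of \<open>D\<close> enters \<open>v\<close>, the arc of
        \<open>C\<close> leaving \<open>v\<close> is taken, otherwise the one entering
        \<open>v\<close>. As loops are excluded, no arc involved does both.\<close>
      show ?thesis
      proof (cases "head H (z D) = v")
        case True
        have "head H out \<noteq> head H (z E) \<and> tail H out \<noteq> tail H (z E)" if "E \<in> S'" for E
        proof -
          have "head H out \<noteq> v" using Suc.prems(3)[OF C out(1)] out(2) by simp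
          moreover have "tail H (z D) \<noteq> v"
            using Suc.prems(3)[OF mS'(2)[OF D(1)], of "z D"] z(1)[OF D(1)] True by simp
          ultimately show ?thesis using shared(1)[OF out(1) that] zE(2)[OF that] out(2) by metis
        qed
        then show ?thesis using out A by blast
      next
        case False
        have "head H inn \<noteq> head H (z E) \<and> tail H inn \<noteq> tail H (z E)" if "E \<in> S'" for E
        proof -
          have "tail H inn \<noteq> v" using Suc.prems(3)[OF C inn(1)] inn(2) by simp
          then show ?thesis using shared(2)[OF inn(1) that] zE(1)[OF that] inn(2) False by metis
        qed
        then show ?thesis using inn A by blast
      qed
    next
      case False
      then have nA: "\<not> in_arcs H v \<subseteq> A" "\<not> out_arcs H v \<subseteq> A" using balanced[OF int] by auto
      obtain e where e: "e \<in> C" "e \<in> A" using Suc.prems(4)[OF C] by auto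
      have "head H e \<noteq> head H (z E) \<and> tail H e \<noteq> tail H (z E)" if E: "E \<in> S'" for E
      proof (intro conjI notI)
        assume eq: "head H e = head H (z E)"
        then have "head H e = v" using shared[OF e(1) E] by simp
        then have "E = D" using zE[OF E] eq by simp
        then have "in_arcs H v = {e, z D}"
          using other_in_arc[OF int, of e "z D"] disj[OF e(1)] eq \<open>head H e = v\<close> arc e z(1)[OF D(1)] by simp
        then show False using nA(1) e z(1)[OF D(1)] by simp
      next
        assume eq: "tail H e = tail H (z E)"
        then have "tail H e = v" using shared[OF e(1) E] by simp
        then have "E = D" using zE[OF E] eq by simp
        then have "out_arcs H v = {e, z D}"
          using other_out_arc[OF int, of e "z D"] disj[OF e(1)] eq \<open>tail H e = v\<close> arc e z(1)[OF D(1)] by simp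
        then show False using nA(2) e z(1)[OF D(1)] by simp
      qed
      then show ?thesis using e by blast
    qed
  qed
  then obtain e where e: "e \<in> C \<inter> A"
    "\<And>D. D \<in> S' \<Longrightarrow> head H e \<noteq> head H (z D) \<and> tail H e \<noteq> tail H (z D)" by blast
  have S: "S = insert C S'" "C \<notin> S'" using C by (auto simp: S'_def)
  show ?case
  proof (intro exI[of _ "z(C := e)"] conjI ballI impI)
    fix D assume "D \<in> S"
    then show "(z(C := e)) D \<in> D \<inter> A" using e z(1) S by auto
  next
    fix D E assume "D \<in> S" "E \<in> S" "D \<noteq> E"
    then show "head H ((z(C := e)) D) \<noteq> head H ((z(C := e)) E)" "tail H ((z(C := e)) D) \<noteq> tail H ((z(C := e)) E)"
      using e(2)[of D] e(2)[of E] z(2)[of D E] S by auto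
  qed
qed

end

text \<open>The \<open>live\<close> conditions say that cutting never strands an uncut arc at an
  internal end, so that walks avoiding \<open>Z\<close> can be prolonged in both directions. They
  are met by suitable cuts for a clique and by the cuts read off a flow.\<close>

locale cut_graph = framed_graph H col for H :: "('a, 'b) pre_digraph" and col +
  fixes Z :: "'b set"
  assumes cut_cycle: "e \<in> Z \<Longrightarrow> \<exists>C. minimal_cycle H C \<and> e \<in> C"
    and cycle_cut: "minimal_cycle H C \<Longrightarrow> \<exists>!e. e \<in> C \<and> e \<in> Z"
    and live_in: "e \<in> arcs H \<Longrightarrow> e \<notin> Z \<Longrightarrow> internal H (tail H e) \<Longrightarrow> \<exists>i \<in> in_arcs H (tail H e). i \<notin> Z"
    and live_out: "e \<in> arcs H \<Longrightarrow> e \<notin> Z \<Longrightarrow> internal H (head H e) \<Longrightarrow> \<exists>i \<in> out_arcs H (head H e). i \<notin> Z"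

context framed_graph
begin

lemma clique_cut:
  assumes K: "clique H col K"
  shows "\<exists>Z. cut_graph H col Z \<and> (\<forall>a \<in> tree (walks K). last a \<notin> Z)"
proof -
  let ?T = "tree (walks K)"
  note good = clique_good_walks[OF K]
  define A where "A = {e. \<forall>a \<in> ?T. last a \<noteq> e}"
  define S where "S = {C. minimal_cycle H C \<and> (\<forall>e \<in> C. head H e \<noteq> tail H e)}"
  define L where "L = {e \<in> arcs H. head H e = tail H e}"
  have "finite S"
    by (rule finite_subset[of _ "Pow (arcs H)"]) (auto simp: S_def dest: minimal_cycle_arcs)
  have meets: "C \<inter> A \<noteq> {}" if "minimal_cycle H C" for C
    using clique_cycle_unused_arc[OF K that] by (auto simp: A_def)
  \<comment> \<open>A used arc leaving \<open>v\<close> has a used arc before it and a used arc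
    entering \<open>v\<close> has one after it, as walks neither start nor end at
    \<open>v\<close>.\<close>
  have balanced: "in_arcs H v \<subseteq> A \<longleftrightarrow> out_arcs H v \<subseteq> A" if v: "internal H v" for v
  proof
    assume inA: "in_arcs H v \<subseteq> A"
    show "out_arcs H v \<subseteq> A"
    proof (rule ccontr)
      assume "\<not> ?thesis"
      then obtain g where "g \<in> out_arcs H v" "g \<notin> A" by blast
      then obtain a where a: "a \<in> ?T" "tail H (last a) = v" unfolding A_def by auto
      obtain b e where b: "a = b @ [e]" using tree_nonempty[OF a(1)] by (cases a rule: rev_cases) auto
      have "b \<noteq> []"
        using tree_source_walks(1)[OF good a(1)] a(2) internal_not_source[OF v] b
        by (auto simp: source_walks_def)
      note b' = tree_snoc[OF good a(1)[unfolded b] this]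
      have "last b \<in> arcs H"
        using tree_source_walks(1)[OF good b'(1)] linked_arcs[of b] \<open>b \<noteq> []\<close> by (auto simp: source_walks_def)
      then have "last b \<in> in_arcs H v" using b'(2) a(2) b by simp
      then show False using inA b'(1) by (auto simp: A_def)
    qed
  next
    assume outA: "out_arcs H v \<subseteq> A"
    show "in_arcs H v \<subseteq> A"
    proof (rule ccontr)
      assume "\<not> ?thesis"
      then obtain g where "g \<in> in_arcs H v" "g \<notin> A" by blast
      then obtain a where a: "a \<in> ?T" "tip a = v" unfolding A_def by auto
      obtain e where e: "a @ [e] \<in> ?T"
        using tree_extend[OF good a(1)] a(2) internal_not_sink[OF v] by auto
      then have "e \<in> out_arcs H v" using tree_snoc[OF good e tree_nonempty[OF a(1)]] a(2) by simp
      then have "e \<in> A" using outA by blast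
      then have "\<forall>a \<in> ?T. last a \<noteq> e" unfolding A_def by simp
      then show False using e by (metis last_snoc)
    qed
  qed
  define selects where "selects z \<longleftrightarrow> (\<forall>C \<in> S. z C \<in> C \<inter> A) \<and>
     (\<forall>C \<in> S. \<forall>D \<in> S. C \<noteq> D \<longrightarrow> head H (z C) \<noteq> head H (z D) \<and> tail H (z C) \<noteq> tail H (z D))" for z
  have "\<exists>z. selects z"
    unfolding selects_def
    by (rule conflict_free_selection[OF \<open>finite S\<close> _ _ meets balanced]) (auto simp: S_def)
  then obtain z where "selects z" by blast
  then have z: "\<And>C. C \<in> S \<Longrightarrow> z C \<in> C \<inter> A"
    "\<And>C D. C \<in> S \<Longrightarrow> D \<in> S \<Longrightarrow> C \<noteq> D \<Longrightarrow> head H (z C) \<noteq> head H (z D) \<and> tail H (z C) \<noteq> tail H (z D)"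
    unfolding selects_def by blast+
  define Z where "Z = z ` S \<union> L"
  have loop: "minimal_cycle H {e}" if "e \<in> L" for e
    using that by (intro directed_cycle_minimal)
      (auto simp: L_def directed_cycle_iff intro!: exI[of _ "[e]"])
  have LA: "e \<in> A" if "e \<in> L" for e using meets[OF loop[OF that]] by simp
  have in_cycle: "\<exists>C. minimal_cycle H C \<and> e \<in> C" if "e \<in> Z" for e
    using that z(1) loop by (auto simp: Z_def S_def)
  have two: "x \<in> L \<and> y \<in> L" if xy: "x \<in> Z" "y \<in> Z" "x \<noteq> y" and v: "head H x = head H y \<or> tail H x = tail H y" for x y
  proof -
    obtain C D where C: "minimal_cycle H C" "x \<in> C" and D: "minimal_cycle H D" "y \<in> D"
      using in_cycle xy by metis
    have vs: "head H x \<in> tail H ` C" "head H y \<in> tail H ` D" 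
      using minimal_cycle_vertices[OF C(1)] minimal_cycle_vertices[OF D(1)] C D by auto
    have LL: "y' \<in> L" if "x' \<in> L" "minimal_cycle H D'" "y' \<in> D'" "tail H x' \<in> tail H ` D'" for x' y' D'
      using loop_vertex_cycle[OF that(2), of x'] that minimal_cycle_arcs[OF that(2)] by (auto simp: L_def)
    consider "x \<in> L" | "y \<in> L" | "x \<in> z ` S" "y \<in> z ` S" using xy by (auto simp: Z_def)
    then show ?thesis
    proof cases
      case 1
      then have "tail H x = tail H y \<or> tail H x = head H y" using v by (auto simp: L_def)
      then have "tail H x \<in> tail H ` D" using vs(2) D(2) by (metis imageI)
      then show ?thesis using LL[OF 1 D] 1 by simp
    next
      case 2
      then have "tail H y = tail H x \<or> tail H y = head H x" using v by (auto simp: L_def)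
      then have "tail H y \<in> tail H ` C" using vs(1) C(2) by (metis imageI)
      then show ?thesis using LL[OF 2 C] 2 by simp
    next
      case 3
      then show ?thesis using z(2) xy(3) v by blast
    qed
  qed
  have L_ends: "e \<in> L \<Longrightarrow> e \<in> in_arcs H v \<longleftrightarrow> e \<in> out_arcs H v" for e v by (auto simp: L_def)
  have "cut_graph H col Z"
  proof
    fix C assume C: "minimal_cycle H C"
    show "\<exists>!e. e \<in> C \<and> e \<in> Z"
    proof (cases "C \<in> S")
      case True
      show ?thesis
      proof (rule ex1I[of _ "z C"])
        fix e assume e: "e \<in> C \<and> e \<in> Z"
        then have "e \<notin> L" using True by (auto simp: S_def L_def)
        then obtain D where "D \<in> S" "e = z D" using e by (auto simp: Z_def)
        then show "e = z C" using minimal_cycle_eq[OF C, of D e] e z(1)[of D] by (auto simp: S_def)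
      qed (use True z in \<open>auto simp: Z_def\<close>)
    next
      case False
      then obtain e where "e \<in> C" "head H e = tail H e" using C by (auto simp: S_def)
      then have "C = {e}" "e \<in> L" using loop_cycle[OF C] minimal_cycle_arcs[OF C] by (auto simp: L_def)
      then show ?thesis by (auto simp: Z_def)
    qed
  next
    fix e assume e: "e \<in> arcs H" "e \<notin> Z" "internal H (tail H e)"
    show "\<exists>i \<in> in_arcs H (tail H e). i \<notin> Z"
    proof (rule ccontr)
      assume "\<not> ?thesis"
      then have *: "in_arcs H (tail H e) \<subseteq> Z" by auto
      obtain i i' where i: "in_arcs H (tail H e) = {i, i'}" "i \<noteq> i'" by (rule in_arcs_pair[OF e(3)])
      have heads: "i \<in> in_arcs H (tail H e)" "i' \<in> in_arcs H (tail H e)" using i by auto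
      then have "i \<in> Z" "i' \<in> Z" "head H i = head H i'" using * by (blast, blast, simp)
      then have "i \<in> L \<and> i' \<in> L" using two i(2) by blast
      then have "out_arcs H (tail H e) = {i, i'}" using heads L_ends other_out_arc[OF e(3)] i(2) by blast
      then have "e \<in> {i, i'}" using e(1) by (metis in_out_arcs_conv)
      then show False using e(2) * i by auto
    qed
  next
    fix e assume e: "e \<in> arcs H" "e \<notin> Z" "internal H (head H e)"
    show "\<exists>i \<in> out_arcs H (head H e). i \<notin> Z"
    proof (rule ccontr)
      assume "\<not> ?thesis"
      then have *: "out_arcs H (head H e) \<subseteq> Z" by auto
      obtain i where i0: "i \<in> out_arcs H (head H e)" using colour_arc(2)[OF e(3)] by blast
      obtain i' where i: "out_arcs H (head H e) = {i, i'}" "i \<noteq> i'" by (rule out_arcs_pair[OF e(3) i0])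
      have tails: "i \<in> out_arcs H (head H e)" "i' \<in> out_arcs H (head H e)" using i by auto
      then have "i \<in> Z" "i' \<in> Z" "tail H i = tail H i'" using * by (blast, blast, simp)
      then have "i \<in> L \<and> i' \<in> L" using two i(2) by blast
      then have "in_arcs H (head H e) = {i, i'}" using tails L_ends other_in_arc[OF e(3)] i(2) by blast
      then have "e \<in> {i, i'}" using e(1) by (metis in_in_arcs_conv)
      then show False using e(2) * i by auto
    qed
  qed (rule in_cycle)
  moreover have "last a \<notin> Z" if "a \<in> ?T" for a
    using that z(1) LA by (auto simp: Z_def A_def)
  ultimately show ?thesis by blast
qed

section \<open>Flows and prefix counts\<close>

text \<open>The number of minimal cycles through \<open>e\<close>, as these are arc-disjoint; it is
  what the cycles can contribute to the prefix count at \<open>e\<close>.\<close>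

definition on_cycle :: "'b \<Rightarrow> nat" where
  "on_cycle e = (if \<exists>C. minimal_cycle H C \<and> e \<in> C then 1 else 0)"

lemma on_cycle_le: "on_cycle e \<le> 1"
  by (simp add: on_cycle_def)

lemma on_cycle_source: "source H (tail H e) \<Longrightarrow> on_cycle e = 0"
  using minimal_cycle_internal(2) internal_not_source by (auto simp: on_cycle_def)

lemma on_cycle_next:
  assumes "e \<in> arcs H" "e' \<in> arcs H" "head H e = tail H e'" "col e = col e'"
  shows "on_cycle e = on_cycle e'"
proof -
  have "(\<exists>C. minimal_cycle H C \<and> e \<in> C) \<longleftrightarrow> (\<exists>C. minimal_cycle H C \<and> e' \<in> C)"
    using minimal_cycle_succ_unique[of _ e e'] minimal_cycle_pred_unique[of _ e' e] assms by metis
  then show ?thesis by (simp add: on_cycle_def)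
qed

text \<open>In-arcs and out-arcs are matched by colour; matched arcs lie on the same minimal cycles,
  because a cycle keeps its colour.\<close>

lemma internal_arcsE:
  assumes "internal H v"
  obtains i i' g g' where "in_arcs H v = {i, i'}" "i \<noteq> i'" "out_arcs H v = {g, g'}" "g \<noteq> g'"
    "on_cycle i = on_cycle g" "on_cycle i' = on_cycle g'"
proof -
  obtain i i' where i: "in_arcs H v = {i, i'}" "i \<noteq> i'" "col i \<noteq> col i'" by (rule in_arcs_pair[OF assms])
  obtain g where g: "g \<in> out_arcs H v" "col g = col i" using colour_arc(2)[OF assms] by blast
  obtain g' where g': "g' \<in> out_arcs H v" "col g' = col i'" using colour_arc(2)[OF assms] by blast
  have "g \<noteq> g'" using g g' i by auto
  moreover have "i \<in> in_arcs H v" "i' \<in> in_arcs H v" using i by auto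
  moreover from this have "i \<in> arcs H" "i' \<in> arcs H" "head H i = v" "head H i' = v" by simp_all
  moreover have "g \<in> arcs H" "g' \<in> arcs H" "tail H g = v" "tail H g' = v" using g g' by simp_all
  ultimately show thesis
    using that[of i i' g g'] i(1,2) other_out_arc[OF assms g(1) g'(1)] on_cycle_next[of i g] on_cycle_next[of i' g'] g g'
    by simp
qed

lemma on_cycle_internal:
  assumes "internal H v" "in_arcs H v \<subseteq> S \<or> out_arcs H v \<subseteq> S" "\<And>e. e \<in> S \<Longrightarrow> on_cycle e = 1"
    "e \<in> in_arcs H v \<or> e \<in> out_arcs H v"
  shows "on_cycle e = 1"
proof (rule internal_arcsE[OF assms(1)])
  fix i i' g g'
  assume "in_arcs H v = {i, i'}" "out_arcs H v = {g, g'}" "on_cycle i = on_cycle g" "on_cycle i' = on_cycle g'"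
  then show ?thesis using assms(2-4) by (smt (verit) insert_iff insert_subset singletonD)
qed

lemma source_in_arcs: "source H v \<Longrightarrow> in_arcs H v = {}"
  using finite_in_arcs[of v] unfolding source_def in_degree_def by (simp add: card_eq_0_iff)

text \<open>\<open>m\<close> stands for the numbers of walk prefixes. A cycle through the arc adds
  one prefix, and the flow is the count less one.\<close>

definition flow_of :: "('b \<Rightarrow> nat) \<Rightarrow> 'b \<Rightarrow> int" where
  "flow_of m = (\<lambda>e \<in> arcs H. int (m e + on_cycle e) - 1)"

text \<open>Cyclic volume flows rewritten for walk prefixes. Weight zero means flow -1 off the
  cycles and flow 0 on them, so the zeros must be exactly the cuts; flow 0 on a source arc becomes
  weight 1.\<close>

definition weighting :: "'b set \<Rightarrow> ('b \<Rightarrow> nat) \<Rightarrow> bool" where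
  "weighting Z m \<longleftrightarrow> (\<forall>e \<in> arcs H. m e = 0 \<longleftrightarrow> e \<in> Z) \<and>
     (\<forall>e \<in> arcs H. source H (tail H e) \<longrightarrow> m e = 1) \<and>
     (\<forall>v. internal H v \<longrightarrow> sum m (out_arcs H v) = sum m (in_arcs H v) + (if v \<in> tail H ` Z then 0 else 1))"

lemma weightingD:
  assumes "weighting Z m"
  shows "e \<in> arcs H \<Longrightarrow> m e = 0 \<longleftrightarrow> e \<in> Z"
    and "e \<in> arcs H \<Longrightarrow> source H (tail H e) \<Longrightarrow> m e = 1"
    and "internal H v \<Longrightarrow> sum m (out_arcs H v) = sum m (in_arcs H v) + (if v \<in> tail H ` Z then 0 else 1)"
  using assms by (auto simp: weighting_def)

text \<open>If both out-arcs of a vertex are cut, an uncut in-arc is a cycle arc with positive flow,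
  and the netflow is negative. If both in-arcs are cut, an uncut out-arc leaves no flow for the
  other one, whose cycle must then be a loop; the loop condition excludes this.\<close>

lemma flow_cut:
  assumes f: "f \<in> cyclic_volume_integer_flows H"
  shows "cut_graph H col {e \<in> arcs H. on_cycle e = 1 \<and> f e = 0}" (is "cut_graph H col ?Z")
proof
  have pos: "0 \<le> f e" if "e \<in> arcs H" for e
    using f that by (auto simp: cyclic_volume_integer_flows_def)
  have unique: "\<exists>!e. e \<in> C \<and> f e = 0" if "minimal_cycle H C" for C
    using f that by (auto simp: cyclic_volume_integer_flows_def)
  have net: "netflow H f v = (if v \<in> zero_tails H f then 0 else 1)" if "internal H v" for v
    using f that by (auto simp: cyclic_volume_integer_flows_def)
  have onc: "on_cycle e = 1" if "minimal_cycle H C" "e \<in> C" for e C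
    using that by (auto simp: on_cycle_def)
  show "\<exists>C. minimal_cycle H C \<and> e \<in> C" if "e \<in> ?Z" for e
    using that by (auto simp: on_cycle_def split: if_splits)
  show "\<exists>!e. e \<in> C \<and> e \<in> ?Z" if C: "minimal_cycle H C" for C
    using unique[OF C] onc[OF C] minimal_cycle_arcs[OF C] by blast
  fix e assume e: "e \<in> arcs H" "e \<notin> ?Z"
  show "\<exists>i \<in> in_arcs H (tail H e). i \<notin> ?Z" if int: "internal H (tail H e)"
  proof (rule ccontr)
    assume "\<not> ?thesis"
    then have Z: "in_arcs H (tail H e) \<subseteq> ?Z" by auto
    have e_out: "e \<in> out_arcs H (tail H e)" using e by simp
    obtain e' where e': "out_arcs H (tail H e) = {e, e'}" "e \<noteq> e'"
      by (rule out_arcs_pair[OF int e_out])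
    then have e'_out: "e' \<in> out_arcs H (tail H e)" by simp
    have cyc: "on_cycle x = 1" if "x \<in> out_arcs H (tail H e)" for x
      using on_cycle_internal[OF int _ _ disjI2[OF that], of ?Z] Z by blast
    have "(\<Sum>i \<in> in_arcs H (tail H e). f i) = 0" using Z by (intro sum.neutral) auto
    \<comment> \<open>The inflow vanishes and the netflow is at most 1. As \<open>e\<close> lies on
      a cycle and is uncut, it takes this unit, which leaves flow zero on \<open>e'\<close>.\<close>
    then have "f e + f e' \<le> 1"
      using net[OF int] e' by (auto simp: netflow_def split: if_splits)
    moreover have "f e \<noteq> 0" using e cyc[OF e_out] by auto
    ultimately have "f e' = 0" using pos[OF e(1)] pos[of e'] e'_out by auto
    obtain D where D: "minimal_cycle H D" "e' \<in> D"
      using cyc[OF e'_out] by (auto simp: on_cycle_def split: if_splits)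
    have t': "tail H e' = tail H e" "e' \<in> arcs H" using e'_out by auto
    obtain i where i: "i \<in> D" "head H i = tail H e'"
      using directed_cycle_pred[OF minimal_cycle_directed[OF D(1)] D(2)] by auto
    have "i \<in> in_arcs H (tail H e)" using i t' minimal_cycle_arcs[OF D(1)] by simp
    then have "f i = 0" using Z by auto
    \<comment> \<open>The cycle of \<open>e'\<close> arrives by a cut arc, so it would have two
      zeros unless that arc is \<open>e'\<close> itself.\<close>
    then have "i = e'" using unique[OF D(1)] i(1) D(2) \<open>f e' = 0\<close> by blast
    then have loop: "head H e' = tail H e'" using i by simp
    obtain E where E: "minimal_cycle H E" "e \<in> E"
      using cyc[OF e_out] by (auto simp: on_cycle_def split: if_splits)
    have "tail H e' \<in> tail H ` E" using E(2) t' by auto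
    then obtain d where d: "E = {d}" "head H d = tail H d"
      by (rule loop_vertex_cycle[OF E(1) t'(2) loop])
    then have "e \<in> in_arcs H (tail H e)" using E(2) e(1) by simp
    then show False using Z e(2) by blast
  qed
  show "\<exists>i \<in> out_arcs H (head H e). i \<notin> ?Z" if int: "internal H (head H e)"
  proof (rule ccontr)
    assume "\<not> ?thesis"
    then have Z: "out_arcs H (head H e) \<subseteq> ?Z" by auto
    have e_in: "e \<in> in_arcs H (head H e)" using e by simp
    have "on_cycle e = 1"
      using on_cycle_internal[OF int _ _ disjI1[OF e_in], of ?Z] Z by blast
    then have "f e > 0" using e pos[OF e(1)] by force
    then have "(\<Sum>i \<in> in_arcs H (head H e). f i) > 0"
      using pos e_in by (intro sum_pos2[of _ e]) auto
    moreover have "(\<Sum>i \<in> out_arcs H (head H e). f i) = 0" using Z by (intro sum.neutral) auto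
    ultimately show False using net[OF int] by (auto simp: netflow_def split: if_splits)
  qed
qed

lemma on_cycle_sum: "internal H v \<Longrightarrow> sum on_cycle (out_arcs H v) = sum on_cycle (in_arcs H v)"
  by (rule internal_arcsE[of v]) auto

text \<open>The shifts by \<open>on_cycle\<close> and by 1 cancel: an internal vertex has as many
  in-arcs as out-arcs, and as many of them on cycles.\<close>

lemma flow_of_netflow:
  assumes "internal H v"
  shows "netflow H (flow_of m) v = int (sum m (out_arcs H v)) - int (sum m (in_arcs H v))"
proof -
  have "(\<Sum>e \<in> S. flow_of m e) = int (sum m S) + int (sum on_cycle S) - int (card S)"
    if "S \<subseteq> arcs H" for S
  proof -
    have "(\<Sum>e \<in> S. flow_of m e) = (\<Sum>e \<in> S. int (m e) + int (on_cycle e) - 1)"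
      using that by (intro sum.cong) (auto simp: flow_of_def)
    then show ?thesis by (simp add: sum.distrib sum_subtractf)
  qed
  moreover have "in_arcs H v \<subseteq> arcs H" "out_arcs H v \<subseteq> arcs H" by auto
  ultimately show ?thesis
    using on_cycle_sum[OF assms] internal_degree[OF assms]
    by (simp add: netflow_def in_degree_def out_degree_def del: of_nat_sum)
qed

lemma flow_weighting:
  assumes f: "f \<in> cyclic_volume_integer_flows H"
  obtains m where "weighting {e \<in> arcs H. on_cycle e = 1 \<and> f e = 0} m" "f = flow_of m"
proof
  let ?Z = "{e \<in> arcs H. on_cycle e = 1 \<and> f e = 0}"
  \<comment> \<open>\<open>flow_of\<close> solved for \<open>m\<close>. Flows are nonnegative and
    \<open>on_cycle\<close> is at most 1, so \<open>nat\<close> truncates nothing on the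
    arcs.\<close>
  define m where "m e = nat (f e + 1 - int (on_cycle e))" for e
  have pos: "0 \<le> f e" if "e \<in> arcs H" for e
    using f that by (auto simp: cyclic_volume_integer_flows_def)
  have m: "int (m e) = f e + 1 - int (on_cycle e)" if "e \<in> arcs H" for e
    using pos[OF that] on_cycle_le[of e] by (simp add: m_def)
  show fm: "f = flow_of m"
    using f m by (auto simp: flow_of_def cyclic_volume_integer_flows_def fun_eq_iff PiE_def extensional_def)
  have zt: "zero_tails H f = tail H ` ?Z"
    unfolding zero_tails_def on_cycle_def using minimal_cycle_arcs
    by (auto simp: image_iff split: if_splits)
  show "weighting ?Z m"
    unfolding weighting_def
  proof (intro conjI ballI allI impI)
    fix e assume e: "e \<in> arcs H"
    show "m e = 0 \<longleftrightarrow> e \<in> ?Z" using m[OF e] pos[OF e] e on_cycle_le[of e] by auto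
    assume s: "source H (tail H e)"
    then have "in_arcs H (tail H e) = {}" by (rule source_in_arcs)
    then have "netflow H f (tail H e) = f e"
      using source_out_arc[OF s, of e] e by (simp add: netflow_def)
    then have "f e = 0" using f s by (simp add: cyclic_volume_integer_flows_def)
    then show "m e = 1" using m[OF e] on_cycle_source[OF s] by simp
  next
    fix v assume v: "internal H v"
    have "netflow H f v = (if v \<in> tail H ` ?Z then 0 else 1)"
      using f v zt by (simp add: cyclic_volume_integer_flows_def)
    then show "sum m (out_arcs H v) = sum m (in_arcs H v) + (if v \<in> tail H ` ?Z then 0 else 1)"
      using flow_of_netflow[OF v, of m] unfolding fm[symmetric]
      by (cases "v \<in> tail H ` ?Z"; simp only: if_True if_False; linarith)
  qed
qed

definition arm :: "'b list set \<Rightarrow> 'b \<Rightarrow> 'b list set" where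
  "arm W e = {a \<in> tree W. last a = e}"

text \<open>The constructors of \<open>route\<close> keep walk prefixes and cycle prefixes apart,
  and at most one minimal cycle contains \<open>e\<close>. Maximal cliques satisfy the condition on
  cycles by \<open>maximal_clique_cycles\<close>.\<close>

lemma num_prefixes_eq:
  assumes K: "clique H col K" and cyc: "\<And>C. minimal_cycle H C \<Longrightarrow> Cycle C \<in> K"
  shows "num_prefixes K e = card (arm (walks K) e) + on_cycle e"
proof -
  define X where "X = {Cycle C | C. minimal_cycle H C \<and> e \<in> C}"
  have KR: "K \<subseteq> Routes H" using K by (simp add: clique_def)
  have "(\<Union>\<rho> \<in> K. prefixes_upto e \<rho>) = Walk ` arm (walks K) e \<union> X"
  proof (intro equalityI subsetI)
    fix x assume "x \<in> (\<Union>\<rho> \<in> K. prefixes_upto e \<rho>)"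
    then obtain \<rho> where \<rho>: "\<rho> \<in> K" "x \<in> prefixes_upto e \<rho>" by auto
    show "x \<in> Walk ` arm (walks K) e \<union> X"
    proof (cases \<rho>)
      case (Cycle C)
      then have "minimal_cycle H C" using \<rho>(1) KR by (auto simp: Routes_def)
      then show ?thesis using \<rho>(2) Cycle by (auto simp: X_def split: if_splits)
    next
      case (Walk p)
      then obtain xs ys where "x = Walk (xs @ [e])" "p = (xs @ [e]) @ ys" using \<rho>(2) by auto
      moreover then have "(xs @ [e]) @ ys \<in> walks K"
        using \<rho>(1) Walk by (simp add: walks_def)
      then have "xs @ [e] \<in> arm (walks K) e" by (auto simp: arm_def tree_def)
      ultimately show ?thesis by auto
    qed
  next
    fix x assume "x \<in> Walk ` arm (walks K) e \<union> X"
    then show "x \<in> (\<Union>\<rho> \<in> K. prefixes_upto e \<rho>)"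
    proof
      assume "x \<in> X"
      then show ?thesis using cyc by (force simp: X_def)
    next
      assume "x \<in> Walk ` arm (walks K) e"
      then obtain a q where a: "x = Walk a" "a \<noteq> []" "last a = e" "Walk (a @ q) \<in> K"
        by (auto simp: arm_def tree_def walks_def)
      then obtain b where b: "a = b @ [e]" by (metis append_butlast_last_id)
      have "x \<in> prefixes_upto e (Walk (a @ q))"
        using a(1) unfolding b by (auto intro!: exI[of _ b])
      then show ?thesis using a(4) by blast
    qed
  qed
  moreover have "finite (arm (walks K) e)" using finite_clique_tree[OF K] by (simp add: arm_def)
  moreover have "card X = on_cycle e \<and> finite X"
  proof (cases "\<exists>C. minimal_cycle H C \<and> e \<in> C")
    case True
    then obtain C where C: "minimal_cycle H C" "e \<in> C" by blast
    then have "X = {Cycle C}" using minimal_cycle_eq by (auto simp: X_def)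
    then show ?thesis using True by (simp add: on_cycle_def)
  next
    case False
    then have "X = {}" by (auto simp: X_def)
    then show ?thesis using False by (simp add: on_cycle_def)
  qed
  moreover have "Walk ` arm (walks K) e \<inter> X = {}" by (auto simp: X_def)
  ultimately show ?thesis
    unfolding num_prefixes_def by (simp add: card_Un_disjoint card_image inj_on_def)
qed

lemma clique_flow_eq:
  assumes "clique H col K" and "\<And>C. minimal_cycle H C \<Longrightarrow> Cycle C \<in> K"
  shows "clique_flow H K = flow_of (\<lambda>e. card (arm (walks K) e))"
  unfolding clique_flow_def flow_of_def using num_prefixes_eq[OF assms] by simp

lemma maximal_clique_cycles:
  assumes "K \<in> maximal_cliques H col" "minimal_cycle H C"
  shows "Cycle C \<in> K"
proof -
  have K: "clique H col K" and max: "\<And>K'. clique H col K' \<Longrightarrow> K \<subseteq> K' \<Longrightarrow> K' = K"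
    using assms(1) by (auto simp: maximal_cliques_def)
  have inc: "\<not> incompatible H col (Cycle C) \<rho>" "\<not> incompatible H col \<rho> (Cycle C)" for \<rho>
    by (cases \<rho>; simp)+
  have "clique H col (insert (Cycle C) K)"
    using K assms(2) inc by (auto simp: clique_def Routes_def pairwise_insert)
  then show ?thesis using max by blast
qed

end

context cut_graph
begin

lemma weighting_flow:
  assumes "weighting Z m"
  shows "flow_of m \<in> cyclic_volume_integer_flows H"
proof -
  note w = weightingD[OF assms]
  have Zarcs: "e \<in> arcs H" if "e \<in> Z" for e using cut_cycle[OF that] minimal_cycle_arcs by blast
  have onZ: "on_cycle e = 1" if "e \<in> Z" for e using cut_cycle[OF that] by (simp add: on_cycle_def)
  have zero: "flow_of m e = 0 \<longleftrightarrow> e \<in> Z" if "minimal_cycle H C" "e \<in> C" for e C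
  proof -
    have "on_cycle e = 1" "e \<in> arcs H" using that minimal_cycle_arcs by (auto simp: on_cycle_def)
    then show ?thesis using w(1)[of e] by (simp add: flow_of_def)
  qed
  have zt: "zero_tails H (flow_of m) = tail H ` Z"
    unfolding zero_tails_def using zero cut_cycle by (auto simp: image_iff) metis
  have "flow_of m \<in> arcs H \<rightarrow>\<^sub>E {0..}"
  proof (rule PiE_I)
    fix e assume e: "e \<in> arcs H"
    \<comment> \<open>Weight zero occurs only on cut arcs, and these lie on cycles, so subtracting 1
      never gives a negative flow.\<close>
    have "m e > 0 \<or> on_cycle e = 1" using w(1)[OF e] onZ by auto
    then show "flow_of m e \<in> {0..}" using e by (auto simp: flow_of_def)
  qed (simp add: flow_of_def)
  moreover have "netflow H (flow_of m) v = 0" if s: "source H v" for v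
  proof -
    have "in_arcs H v = {}" using s by (rule source_in_arcs)
    moreover have "card (out_arcs H v) = 1"
      using source_degree[OF s] s by (simp add: source_def out_degree_def)
    then obtain e where "out_arcs H v = {e}" by (rule card_1_singletonE)
    moreover then have "e \<in> arcs H" "tail H e = v" by auto
    ultimately show ?thesis
      using w(2)[of e] s on_cycle_source[of e] by (simp add: netflow_def flow_of_def)
  qed
  moreover have "\<exists>!e. e \<in> C \<and> flow_of m e = 0" if "minimal_cycle H C" for C
    using cycle_cut[OF that] zero[OF that] by metis
  moreover have "netflow H (flow_of m) v = (if v \<in> zero_tails H (flow_of m) then 0 else 1)"
    if "internal H v" for v
    unfolding zt flow_of_netflow[OF that] w(3)[OF that] by simp
  ultimately show ?thesis by (simp add: cyclic_volume_integer_flows_def)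
qed

section \<open>The acyclic relation on uncut arcs\<close>

definition succ_rel :: "('b \<times> 'b) set" where
  "succ_rel = {(e, e'). e \<in> arcs H - Z \<and> e' \<in> arcs H - Z \<and> head H e = tail H e'}"

lemma uncut_cycle_free:
  assumes "set p \<inter> Z = {}"
  shows "cycle_free p"
  unfolding cycle_free_def
proof (intro notI, elim exE conjE)
  fix xs ys zs assume "p = xs @ ys @ zs" "minimal_cycle H (set ys)"
  then show False using cycle_cut[of "set ys"] assms by auto
qed

text \<open>A chain of uncut arcs returning to its start yields a closed list, which contains a
  minimal cycle and with it a cut arc.\<close>

lemma acyclic_succ_rel: "acyclic succ_rel"
proof -
  have "\<exists>p. linked (e # p @ [e']) \<and> set (e # p @ [e']) \<inter> Z = {}" if "(e, e') \<in> succ_rel\<^sup>+" for e e'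
    using that
  proof (induction rule: trancl_induct)
    case (base y)
    then show ?case by (intro exI[of _ "[]"]) (auto simp: succ_rel_def linked_Cons)
  next
    case (step y z)
    then obtain p where "linked (e # p @ [y])" "set (e # p @ [y]) \<inter> Z = {}" by blast
    then show ?case using step(2)
      by (intro exI[of _ "p @ [y]"]) (auto simp: succ_rel_def linked_append linked_Cons hd_append split: if_splits)
  qed
  moreover have False if "linked (e # p @ [e])" "set (e # p @ [e]) \<inter> Z = {}" for e p
  proof -
    have "\<not> cycle_free (p @ [e])"
      using that(1) by (intro closed_not_cycle_free) (auto simp: linked_Cons linked_append hd_append)
    then show False using uncut_cycle_free[of "p @ [e]"] that(2) by auto
  qed
  ultimately show ?thesis unfolding acyclic_def by blast
qed

lemma finite_succ_rel: "finite succ_rel"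
  by (rule finite_subset[of _ "arcs H \<times> arcs H"]) (auto simp: succ_rel_def)

text \<open>One direction serves inductions from the sources onwards, the other the prolongation of
  walks towards the sinks.\<close>

lemma wf_succ_rel: "wf succ_rel" "wf (succ_rel\<inverse>)"
  using finite_acyclic_wf finite_acyclic_wf_converse finite_succ_rel acyclic_succ_rel by auto

end

context framed_graph
begin

section \<open>Saturation of maximal cliques\<close>

definition ending_at :: "'b list set \<Rightarrow> 'a \<Rightarrow> 'b list set" where
  "ending_at W v = {a \<in> tree W. tip a = v}"

definition extendable :: "'b list set \<Rightarrow> 'b \<Rightarrow> 'b list set" where
  "extendable W e = {a \<in> ending_at W (tail H e). a @ [e] \<in> tree W}"

lemma ending_at_source_walks:
  assumes "W \<subseteq> {p. good_walk H p}"
  shows "ending_at W v \<subseteq> source_walks v"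
  using tree_source_walks(1)[OF assms] by (auto simp: ending_at_def)

lemma arm_snoc_extendable:
  assumes W: "W \<subseteq> {p. good_walk H p}" and v: "internal H (tail H e)"
  shows "arm W e = (\<lambda>a. a @ [e]) ` extendable W e"
proof (intro equalityI subsetI)
  fix x assume x: "x \<in> arm W e"
  then obtain a where a: "x = a @ [e]"
    using tree_nonempty unfolding arm_def by (metis (mono_tags, lifting) append_butlast_last_id mem_Collect_eq)
  have T: "a @ [e] \<in> tree W" using x a by (simp add: arm_def)
  have "a \<noteq> []"
    using tree_source_walks(1)[OF W T] internal_not_source[OF v] by (auto simp: source_walks_def)
  from tree_snoc[OF W T this] have "a \<in> extendable W e" using T by (simp add: extendable_def ending_at_def)
  then show "x \<in> (\<lambda>a. a @ [e]) ` extendable W e" using a by blast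
qed (auto simp: extendable_def arm_def)

lemma card_arm_extendable:
  assumes "W \<subseteq> {p. good_walk H p}" "internal H (tail H e)"
  shows "card (arm W e) = card (extendable W e)"
  unfolding arm_snoc_extendable[OF assms] by (rule card_image) (simp add: inj_on_def)

lemma ending_at_arms:
  assumes W: "W \<subseteq> {p. good_walk H p}"
  shows "ending_at W v = (\<Union>e \<in> in_arcs H v. arm W e)"
proof (intro equalityI subsetI)
  fix a assume a: "a \<in> ending_at W v"
  then have "a \<in> tree W" "tip a = v" by (auto simp: ending_at_def)
  moreover from this have "last a \<in> arcs H"
    using tree_source_walks(1)[OF W, of a] linked_arcs[of a] by (auto simp: source_walks_def)
  ultimately show "a \<in> (\<Union>e \<in> in_arcs H v. arm W e)" by (simp add: arm_def)
qed (auto simp: ending_at_def arm_def)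

lemma card_ending_at:
  assumes "W \<subseteq> {p. good_walk H p}" "finite (tree W)"
  shows "card (ending_at W v) = (\<Sum>e \<in> in_arcs H v. card (arm W e))"
  unfolding ending_at_arms[OF assms(1)] using assms(2)
  by (intro card_UN_disjoint) (auto simp: arm_def)

lemma ending_at_extendable:
  assumes W: "W \<subseteq> {p. good_walk H p}" and v: "internal H v"
  shows "ending_at W v = (\<Union>e \<in> out_arcs H v. extendable W e)"
proof (intro equalityI subsetI)
  fix a assume a: "a \<in> ending_at W v"
  then have T: "a \<in> tree W" "tip a = v" by (auto simp: ending_at_def)
  obtain e where e: "a @ [e] \<in> tree W"
    using tree_extend[OF W T(1)] T(2) internal_not_sink[OF v] by auto
  have "tail H e = v" "e \<in> arcs H" using tree_snoc[OF W e tree_nonempty[OF T(1)]] T(2) by auto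
  then show "a \<in> (\<Union>e \<in> out_arcs H v. extendable W e)" using a e by (auto simp: extendable_def)
qed (auto simp: extendable_def)

lemma source_arm:
  assumes W: "W \<subseteq> {p. good_walk H p}" and s: "source H (tail H e)"
  shows "arm W e \<subseteq> {[e]}"
proof
  fix a assume a: "a \<in> arm W e"
  then have T: "a \<in> tree W" "last a = e" by (auto simp: arm_def)
  obtain b where b: "a = b @ [e]" using T tree_nonempty by (metis append_butlast_last_id)
  have "b = []"
  proof (rule ccontr)
    assume ne: "b \<noteq> []"
    have Tb: "b @ [e] \<in> tree W" using T b by simp
    note t = tree_snoc[OF W Tb ne]
    have "last b \<in> arcs H"
      using tree_source_walks(1)[OF W t(1)] linked_arcs[of b] ne by (auto simp: source_walks_def)
    then show False using not_source_head[of "last b"] t(2) s by simp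
  qed
  then show "a \<in> {[e]}" using b by simp
qed

lemma extendable_noncrossing:
  assumes "noncrossing W W" "a \<in> extendable W e" "b \<in> extendable W e'" "e \<noteq> e'" "tail H e = tail H e'"
  shows "\<not> before (col e) b a"
proof -
  have "a \<noteq> []" "b \<noteq> []" using assms(2,3) tree_nonempty unfolding extendable_def ending_at_def by blast+
  then show ?thesis
    using noncrossingD[OF assms(1), of a e b e'] assms(2-5) by (simp add: extendable_def ending_at_def)
qed

lemma tree_single_snoc: "tree {p @ [e]} = insert (p @ [e]) (tree {p})" for e :: 'b
  unfolding tree_def by (auto simp: append_eq_append_conv2 append_eq_Cons_conv)

text \<open>The only new prefix is \<open>p @ [e]\<close>, so new comparisons arise only at the tip
  of \<open>p\<close>.\<close>

lemma noncrossing_snoc: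
  assumes "noncrossing {p} W"
    and "\<And>b e'. b @ [e'] \<in> tree W \<Longrightarrow> b \<noteq> [] \<Longrightarrow> tip p = tip b \<Longrightarrow> e \<noteq> e' \<Longrightarrow> \<not> before (col e) b p"
  shows "noncrossing {p @ [e]} W"
  using assms unfolding noncrossing_def tree_single_snoc by blast

end

context cut_graph
begin

text \<open>\<open>p\<close> is prolonged along uncut arcs to a sink. If both out-arcs were blocked,
  then in the order of \<open>col e\<close> a prefix \<open>b\<close> taking \<open>e'\<close> would
  precede \<open>p\<close>, and \<open>p\<close> would precede a prefix \<open>d\<close> taking
  \<open>e\<close>. So \<open>b\<close> precedes \<open>d\<close>, a crossing inside
  \<open>K\<close>.\<close>

lemma noncrossing_extension:
  assumes K: "clique H col K" and avoid: "\<And>a. a \<in> tree (walks K) \<Longrightarrow> last a \<notin> Z"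
    and "p \<in> source_walks v" "set p \<inter> Z = {}" "noncrossing {p} (walks K)"
  shows "\<exists>q. good_walk H (p @ q) \<and> noncrossing {p @ q} (walks K)"
  using assms(3-5)
proof (induction "last p" arbitrary: p v rule: wf_induct_rule[OF wf_succ_rel(2)])
  case 1
  note good = clique_good_walks[OF K]
  have p: "p \<noteq> []" "linked p" "source H (tail H (hd p))" "tip p = v"
    using 1(2) by (auto simp: source_walks_def)
  have last: "last p \<in> arcs H" "last p \<notin> Z" using p linked_arcs[of p] 1(3) last_in_set[of p] by (blast, blast)
  show ?case
  proof (cases "internal H v")
    case False
    then have "sink H (tip p)" using not_internal_head[OF last(1)] p(4) by simp
    then have "good_walk H p" using p uncut_cycle_free[OF 1(3)] by (simp add: good_walk_iff)
    then show ?thesis using 1(4) by (intro exI[of _ "[]"]) simp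
  next
    case True
    have "\<exists>e \<in> out_arcs H v. e \<notin> Z \<and>
      (\<forall>b e'. b @ [e'] \<in> tree (walks K) \<and> b \<noteq> [] \<and> tip p = tip b \<and> e \<noteq> e' \<longrightarrow> \<not> before (col e) b p)"
    proof (rule ccontr)
      assume none: "\<not> ?thesis"
      obtain e where e: "e \<in> out_arcs H v" "e \<notin> Z" using live_out[OF last] p(4) True by auto
      then obtain b e' where b: "b @ [e'] \<in> tree (walks K)" "b \<noteq> []" "tip p = tip b" "e \<noteq> e'"
        "before (col e) b p" using none by blast
      note bt = tree_snoc[OF good b(1,2)]
      have e'_out: "e' \<in> out_arcs H v" using bt b(3) p(4) by simp
      \<comment> \<open>The obstruction comes from a walk of \<open>K\<close>, so the other out-arc
        is uncut too and must be blocked as well.\<close>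
      have "e' \<notin> Z" using avoid[OF b(1)] by simp
      then obtain d g where d: "d @ [g] \<in> tree (walks K)" "d \<noteq> []" "tip p = tip d" "e' \<noteq> g"
        "before (col e') d p" using none e'_out by blast
      note dt = tree_snoc[OF good d(1,2)]
      have "out_arcs H v = {e, e'}" using other_out_arc[OF True e(1) e'_out b(4)] .
      moreover have "g \<in> out_arcs H v" using dt d(3) p(4) by simp
      ultimately have "g = e" using d(4) by auto
      have "col e \<noteq> col e'" using out_arc_eq[of e e'] e e'_out b(4) by auto
      then have "before (col e) p d" using before_flip d(5) by blast
      then have "before (col e) b d"
        using before_trans[of b v d] b(3,5) d(3) p(4) tree_source_walks(1)[OF good bt(1)]
          tree_source_walks(1)[OF good dt(1)] by metis
      moreover have "\<not> before (col e) b d"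
        using noncrossingD[OF clique_noncrossing[OF K] d(1)[unfolded \<open>g = e\<close>] b(1)] d b by simp
      ultimately show False by simp
    qed
    then obtain e where e: "e \<in> out_arcs H v" "e \<notin> Z"
      "\<And>b e'. b @ [e'] \<in> tree (walks K) \<Longrightarrow> b \<noteq> [] \<Longrightarrow> tip p = tip b \<Longrightarrow> e \<noteq> e' \<Longrightarrow> \<not> before (col e) b p"
      by blast
    have "(last (p @ [e]), last p) \<in> succ_rel\<inverse>" using e last p(4) by (auto simp: succ_rel_def)
    moreover have "p @ [e] \<in> source_walks (head H e)"
      using p e(1) by (auto simp: source_walks_def linked_append)
    moreover have "set (p @ [e]) \<inter> Z = {}" using 1(3) e(2) by auto
    moreover have "noncrossing {p @ [e]} (walks K)" by (rule noncrossing_snoc[OF 1(4) e(3)])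
    ultimately obtain q where "good_walk H ((p @ [e]) @ q)" "noncrossing {(p @ [e]) @ q} (walks K)"
      using 1(1) by blast
    then show ?thesis by (metis append.assoc)
  qed
qed

lemma maximal_clique_tree:
  assumes K: "K \<in> maximal_cliques H col" and avoid: "\<And>a. a \<in> tree (walks K) \<Longrightarrow> last a \<notin> Z"
    and p: "p \<in> source_walks v" "set p \<inter> Z = {}" "noncrossing {p} (walks K)"
  shows "p \<in> tree (walks K)"
proof -
  have cl: "clique H col K" and max: "\<And>K'. clique H col K' \<Longrightarrow> K \<subseteq> K' \<Longrightarrow> K' = K"
    using K by (auto simp: maximal_cliques_def)
  obtain q where q: "good_walk H (p @ q)" "noncrossing {p @ q} (walks K)"
    using noncrossing_extension[OF cl avoid p] by blast
  have compat: "\<not> incompatible H col (Walk (p @ q)) \<rho> \<and> \<not> incompatible H col \<rho> (Walk (p @ q))"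
    if "\<rho> \<in> K" for \<rho>
  proof (cases \<rho>)
    case (Walk p')
    then have p': "p' \<in> walks K" using that by (simp add: walks_def)
    then have "noncrossing {p @ q} {p'}"
      using q(2) unfolding noncrossing_def tree_def by blast
    moreover have "linked (p @ q)" "linked p'" using q(1) clique_good[OF cl p'] good_walk_iff by auto
    ultimately show ?thesis using noncrossing_not_crossing Walk by simp
  qed simp
  have "clique H col (insert (Walk (p @ q)) K)"
    using cl q(1) compat by (auto simp: clique_def Routes_def pairwise_insert)
  then have "Walk (p @ q) \<in> K" using max by blast
  then show ?thesis using p(1) by (auto simp: tree_def walks_def source_walks_def)
qed

text \<open>The excess 1 is the size of the intersection in inclusion-exclusion; next to a cut all
  prefixes take the other out-arc and there is no excess. That uncut arcs are used must be shown on
  the way, as an overlap requires some prefix at the vertex.\<close>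

lemma maximal_clique_weighting:
  assumes K: "K \<in> maximal_cliques H col" and avoid: "\<And>a. a \<in> tree (walks K) \<Longrightarrow> last a \<notin> Z"
  shows "weighting Z (\<lambda>e. card (arm (walks K) e))"
proof -
  define W where "W = walks K"
  have cl: "clique H col K" using K by (simp add: maximal_cliques_def)
  have good: "W \<subseteq> {p. good_walk H p}" using clique_good_walks[OF cl] by (simp add: W_def)
  have fin: "finite (tree W)" using finite_clique_tree[OF cl] by (simp add: W_def)
  have nc: "noncrossing W W" using clique_noncrossing[OF cl] by (simp add: W_def)
  have av: "last a \<notin> Z" if "a \<in> tree W" for a using avoid that by (simp add: W_def)
  have tree: "p \<in> tree W" if "p \<in> source_walks v" "set p \<inter> Z = {}" "noncrossing {p} W" for p v
    using maximal_clique_tree[OF K avoid] that by (simp add: W_def)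
  have avoid_set: "set a \<inter> Z = {}" if "a \<in> tree W" for a
  proof -
    have "x \<notin> Z" if x: "x \<in> set a" for x
    proof -
      obtain b c where "a = b @ x # c" using x by (meson split_list)
      then have "b @ [x] \<in> tree W" using \<open>a \<in> tree W\<close> tree_prefix[of "b @ [x]" c W] by simp
      then show ?thesis using av by fastforce
    qed
    then show ?thesis by blast
  qed
  have tree_nc: "noncrossing {a} W" if "a \<in> tree W" for a
  proof -
    have "tree {a} \<subseteq> tree W" using that by (auto simp: tree_def)
    then show ?thesis using nc unfolding noncrossing_def by blast
  qed
  have arm_cut: "arm W e = {}" if "e \<in> Z" for e using av that by (auto simp: arm_def)
  \<comment> \<open>Saturation in local form: a prefix also continues along \<open>e\<close> unless
    one taking the other out-arc precedes it in the order of \<open>col e\<close>.\<close>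
  have snoc: "a \<in> extendable W e"
    if v: "internal H (tail H e)" "e \<in> arcs H" "e \<notin> Z" "out_arcs H (tail H e) = {e, e'}"
      and a: "a \<in> ending_at W (tail H e)" and b: "\<And>b. b \<in> extendable W e' \<Longrightarrow> \<not> before (col e) b a" for a e e'
  proof -
    have T: "a \<in> tree W" "tip a = tail H e" using a by (auto simp: ending_at_def)
    have "a @ [e] \<in> source_walks (head H e)"
      using tree_source_walks(1)[OF good T(1)] v(2) T(2) by (auto simp: source_walks_def linked_append)
    moreover have "set (a @ [e]) \<inter> Z = {}" using avoid_set[OF T(1)] v(3) by auto
    moreover have "noncrossing {a @ [e]} W"
    proof (rule noncrossing_snoc[OF tree_nc[OF T(1)]])
      fix c g assume c: "c @ [g] \<in> tree W" "c \<noteq> []" "tip a = tip c" "e \<noteq> g"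
      note ct = tree_snoc[OF good c(1,2)]
      have "g \<in> out_arcs H (tail H e)" using ct c(3) T(2) by simp
      then have "g = e'" using v(4) c(4) by auto
      then have "c \<in> extendable W e'" using c ct by (simp add: extendable_def ending_at_def)
      then show "\<not> before (col e) c a" by (rule b)
    qed
    ultimately have "a @ [e] \<in> tree W" by (rule tree)
    then show ?thesis using a by (simp add: extendable_def)
  qed
  have out_int: "on_cycle e = 1 \<and> internal H (tail H e)" if "e \<in> Z" for e
    using cut_cycle[OF that] minimal_cycle_internal(2) by (auto simp: on_cycle_def)
  have fin_ext: "finite (extendable W e)" for e using fin by (simp add: extendable_def ending_at_def)
  have overlap: "\<exists>x. extendable W e \<inter> extendable W e' = {x}"
    if v: "internal H v" "out_arcs H v = {e, e'}" "e \<noteq> e'" "e \<notin> Z" "e' \<notin> Z" and ne: "ending_at W v \<noteq> {}" for v e e'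
  proof -
    have "e \<in> out_arcs H v" "e' \<in> out_arcs H v" using v(2) by auto
    then have e: "e \<in> arcs H" "tail H e = v" and e': "e' \<in> arcs H" "tail H e' = v" by auto
    have cc: "col e \<noteq> col e'" using out_arc_eq[of e e'] e e' v(3) by auto
    have out': "out_arcs H v = {e', e}" using v(2) by auto
    have union: "ending_at W v = extendable W e \<union> extendable W e'" using ending_at_extendable[OF good v(1)] v(2) by auto
    have order: "finite_order (before c) X" if "X \<subseteq> ending_at W v" for c X
      using that ending_at_source_walks[OF good, of v] fin
      by (intro finite_order_before[of _ v]) (auto simp: ending_at_def intro: finite_subset)
    have snoc_e: "a \<in> extendable W e" if "a \<in> ending_at W v" "\<And>b. b \<in> extendable W e' \<Longrightarrow> \<not> before (col e) b a" for a
      using snoc[of e e' a] e v that by simp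
    have snoc_e': "a \<in> extendable W e'" if "a \<in> ending_at W v" "\<And>b. b \<in> extendable W e \<Longrightarrow> \<not> before (col e') b a" for a
      using snoc[of e' e a] e' v that out' by simp
    \<comment> \<open>Were it empty, the first prefix in the order of \<open>col e'\<close> would
      meet no obstruction along \<open>e'\<close>.\<close>
    have "extendable W e' \<noteq> {}"
    proof
      assume empty: "extendable W e' = {}"
      obtain x where x: "x \<in> ending_at W v" "\<And>y. y \<in> ending_at W v \<Longrightarrow> \<not> before (col e') y x"
        using finite_order.minimum[OF order[OF subset_refl] ne] by blast
      then have "x \<in> extendable W e'" using snoc_e'[OF x(1)] union by blast
      then show False using empty by simp
    qed
    have sub': "extendable W e' \<subseteq> ending_at W v" using union by simp
    \<comment> \<open>The shared prefix is the \<open>col e\<close>-first among those taking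
      \<open>e'\<close>: none of these precedes it, so it takes \<open>e\<close> as well.\<close>
    obtain x where x: "x \<in> extendable W e'" "\<And>y. y \<in> extendable W e' \<Longrightarrow> \<not> before (col e) y x"
      using finite_order.minimum[OF order[OF sub'] \<open>extendable W e' \<noteq> {}\<close>] by blast
    have "x \<in> extendable W e" using snoc_e x union by blast
    \<comment> \<open>Two shared prefixes would be comparable, and letting the earlier one take
      \<open>e'\<close> and the later one \<open>e\<close> gives a crossing.\<close>
    moreover have "y = x" if y: "y \<in> extendable W e \<inter> extendable W e'" for y
    proof (rule ccontr)
      assume "y \<noteq> x"
      then have "before (col e) y x \<or> before (col e) x y"
        using before_total[of y v x] y x(1) union ending_at_source_walks[OF good, of v] by blast
      then show False
        using extendable_noncrossing[OF nc \<open>x \<in> extendable W e\<close> _ v(3), of y] extendable_noncrossing[OF nc _ x(1) v(3), of y]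
          y e e' by auto
    qed
    ultimately show ?thesis using x(1) by blast
  qed
  \<comment> \<open>Induction from the sources: \<open>live_in\<close> provides an uncut in-arc,
    hence a prefix at the vertex that can be continued.\<close>
  have arm_nonempty: "arm W e \<noteq> {}" if "e \<in> arcs H" "e \<notin> Z" for e
    using that
  proof (induction e rule: wf_induct_rule[OF wf_succ_rel(1)])
    case (1 e)
    show ?case
    proof (cases "internal H (tail H e)")
      case False
      then have s: "source H (tail H e)" using not_internal_tail 1(2) by blast
      have "[e] \<in> tree W"
        by (rule tree[of _ "head H e"])
          (use 1 s in \<open>auto simp: source_walks_def noncrossing_def tree_def append_eq_Cons_conv\<close>)
      then show ?thesis by (auto simp: arm_def)
    next
      case True
      obtain i where i: "i \<in> in_arcs H (tail H e)" "i \<notin> Z" using live_in[OF 1(2,3) True] by blast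
      have "(i, e) \<in> succ_rel" using i 1(2,3) by (simp add: succ_rel_def)
      then have "arm W i \<noteq> {}" using 1(1) i by simp
      then have ne: "ending_at W (tail H e) \<noteq> {}" using ending_at_arms[OF good] i(1) by blast
      have "e \<in> out_arcs H (tail H e)" using 1(2) by simp
      then obtain e' where e': "out_arcs H (tail H e) = {e, e'}" "e \<noteq> e'"
        by (rule out_arcs_pair[OF True])
      have "e' \<in> out_arcs H (tail H e)" using e' by simp
      then have te': "tail H e' = tail H e" by simp
      have "extendable W e \<noteq> {}"
      proof (cases "e' \<in> Z")
        case True
        have "extendable W e' = {}" using av True by (fastforce simp: extendable_def)
        then show ?thesis using ne ending_at_extendable[OF good \<open>internal H (tail H e)\<close>] e' by auto
      next
        case False
        then show ?thesis using overlap[OF True e' 1(3) False ne] by blast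
      qed
      then show ?thesis using arm_snoc_extendable[OF good True] by simp
    qed
  qed
  have "weighting Z (\<lambda>e. card (arm W e))"
    unfolding weighting_def
  proof (intro conjI ballI allI impI)
    fix e assume e: "e \<in> arcs H"
    have "finite (arm W e)" using fin by (simp add: arm_def)
    then show "card (arm W e) = 0 \<longleftrightarrow> e \<in> Z" using arm_cut arm_nonempty[OF e] by auto
    assume s: "source H (tail H e)"
    then have "e \<notin> Z" using out_int internal_not_source by blast
    then have "arm W e = {[e]}" using arm_nonempty[OF e] source_arm[OF good s] by blast
    then show "card (arm W e) = 1" by simp
  next
    fix v assume v: "internal H v"
    have sum: "(\<Sum>e \<in> {e, e'}. card (arm W e)) = card (extendable W e) + card (extendable W e')" 
      if "out_arcs H v = {e, e'}" "e \<noteq> e'" for e e'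
    proof -
      have "e \<in> out_arcs H v" "e' \<in> out_arcs H v" using that by auto
      then show ?thesis using that(2) card_arm_extendable[OF good] v by simp
    qed
    show "(\<Sum>e \<in> out_arcs H v. card (arm W e)) =
      (\<Sum>e \<in> in_arcs H v. card (arm W e)) + (if v \<in> tail H ` Z then 0 else 1)"
    proof (cases "v \<in> tail H ` Z")
      case True
      then obtain e where e: "e \<in> Z" "tail H e = v" by auto
      then have "e \<in> out_arcs H v" using cut_cycle[OF e(1)] minimal_cycle_arcs by auto
      then obtain e' where e': "out_arcs H v = {e, e'}" "e \<noteq> e'" by (rule out_arcs_pair[OF v])
      have "extendable W e = {}" using av e by (fastforce simp: extendable_def)
      then have "ending_at W v = extendable W e'" using ending_at_extendable[OF good v] e'(1) by simp
      then show ?thesis using True sum[OF e'] e'(1) card_ending_at[OF good fin, of v] \<open>extendable W e = {}\<close> by simp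
    next
      case False
      obtain e where e_out: "e \<in> out_arcs H v" using colour_arc(2)[OF v] by blast
      obtain e' where e': "out_arcs H v = {e, e'}" "e \<noteq> e'" by (rule out_arcs_pair[OF v e_out])
      have te: "tail H e = v" "e \<in> arcs H" using e_out by auto
      have "e' \<in> out_arcs H v" using e' by simp
      then have "tail H e' = v" by simp
      then have nZ: "e \<notin> Z" "e' \<notin> Z" using False te by (metis imageI)+
      obtain i where i: "i \<in> in_arcs H v" "i \<notin> Z" using live_in[OF te(2) nZ(1)] te v by auto
      then have "ending_at W v \<noteq> {}" using ending_at_arms[OF good, of v] arm_nonempty[of i] by auto
      then obtain x where x: "extendable W e \<inter> extendable W e' = {x}" using overlap[OF v e' nZ] by blast
      have "ending_at W v = extendable W e \<union> extendable W e'" using ending_at_extendable[OF good v] e'(1) by auto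
      then have "card (extendable W e) + card (extendable W e') = card (ending_at W v) + 1"
        using card_Un_Int[OF fin_ext[of e] fin_ext[of e']] x by simp
      then show ?thesis using False sum[OF e'] e'(1) card_ending_at[OF good fin, of v] by simp
    qed
  qed
  then show ?thesis by (simp add: W_def)
qed

section \<open>Reconstruction of a clique from its flow\<close>

text \<open>The union omits \<open>Z\<close> so that for an uncut \<open>e\<close> only arcs
  preceding it in \<open>succ_rel\<close> are consulted, where \<open>wfrec\<close> supplies the
  intended values.\<close>

definition sprout_step :: "('b \<Rightarrow> nat) \<Rightarrow> ('b \<Rightarrow> 'b list set) \<Rightarrow> 'b \<Rightarrow> 'b list set" where
  "sprout_step m T e =
     (if internal H (tail H e)
      then (\<lambda>a. a @ [e]) ` seg (before (col e)) (m e) (\<Union>i \<in> in_arcs H (tail H e) - Z. T i)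
      else {[e]})"

definition sprout :: "('b \<Rightarrow> nat) \<Rightarrow> 'b \<Rightarrow> 'b list set" where
  "sprout m = wfrec succ_rel (sprout_step m)"

definition sprouts_at :: "('b \<Rightarrow> nat) \<Rightarrow> 'a \<Rightarrow> 'b list set" where
  "sprouts_at m v = (\<Union>i \<in> in_arcs H v. sprout m i)"

lemma cut_internal: "e \<in> Z \<Longrightarrow> internal H (tail H e)"
  using cut_cycle minimal_cycle_internal(2) by blast

lemma sprout_unfold: "sprout m e = sprout_step m (cut (sprout m) succ_rel e) e"
  unfolding sprout_def by (rule wfrec[OF wf_succ_rel(1)])

text \<open>Nothing precedes a cut arc in \<open>succ_rel\<close>, so the recursive values are
  unspecified there; a segment of size 0 is empty in any case.\<close>

lemma sprout_cut:
  assumes "weighting Z m" "e \<in> Z"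
  shows "sprout m e = {}"
proof -
  have "e \<in> arcs H" using assms(2) cut_cycle minimal_cycle_arcs by blast
  then have "m e = 0" using weightingD(1)[OF assms(1)] assms(2) by simp
  then show ?thesis
    unfolding sprout_unfold[of m e] sprout_step_def using cut_internal[OF assms(2)] by (simp add: seg_def)
qed

lemma sprout_source: "source H (tail H e) \<Longrightarrow> sprout m e = {[e]}"
  unfolding sprout_unfold[of m e] sprout_step_def using internal_not_source by auto

lemma sprout_internal:
  assumes "weighting Z m" "e \<in> arcs H" "internal H (tail H e)"
  shows "sprout m e = (\<lambda>a. a @ [e]) ` seg (before (col e)) (m e) (sprouts_at m (tail H e))"
proof (cases "e \<in> Z")
  case True
  then have "m e = 0" using weightingD(1)[OF assms(1,2)] by simp
  then show ?thesis using sprout_cut[OF assms(1) True] by (simp add: seg_def)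
next
  case False
  have "(\<Union>i \<in> in_arcs H (tail H e) - Z. cut (sprout m) succ_rel e i)
      = (\<Union>i \<in> in_arcs H (tail H e) - Z. sprout m i)"
    using False assms(2) by (intro SUP_cong) (auto simp: cut_def succ_rel_def)
  also have "\<dots> = sprouts_at m (tail H e)"
    unfolding sprouts_at_def using sprout_cut[OF assms(1)] by blast
  finally show ?thesis
    unfolding sprout_unfold[of m e] sprout_step_def using assms(3) by simp
qed

text \<open>The prefixes continuing along \<open>e\<close> are closed downwards in the order of
  \<open>col e\<close>: one that precedes them but takes the other out-arc would cross. By
  \<open>seg_unique\<close> their number \<open>m e\<close> then determines them.\<close>

lemma clique_arm_sprout:
  assumes K: "clique H col K" and m: "weighting Z m"
    and card: "\<And>e. e \<in> arcs H \<Longrightarrow> card (arm (walks K) e) = m e" and "e \<in> arcs H"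
  shows "arm (walks K) e = sprout m e"
  using \<open>e \<in> arcs H\<close>
proof (induction e rule: wf_induct_rule[OF wf_succ_rel(1)])
  case (1 e)
  note good = clique_good_walks[OF K]
  have fin: "finite (arm (walks K) e)" using finite_clique_tree[OF K] by (simp add: arm_def)
  show ?case
  proof (cases "internal H (tail H e)")
    case False
    then have s: "source H (tail H e)" using not_internal_tail 1(2) by blast
    have "card (arm (walks K) e) = 1" using weightingD(2)[OF m 1(2) s] card[OF 1(2)] by simp
    then have "arm (walks K) e = {[e]}" using source_arm[OF good s] by (metis card.empty subset_singletonD zero_neq_one)
    then show ?thesis using sprout_source[OF s] by simp
  next
    case v: True
    show ?thesis
    proof (cases "e \<in> Z")
      case True
      then have "arm (walks K) e = {}" using card[OF 1(2)] weightingD(1)[OF m 1(2)] fin by simp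
      then show ?thesis using sprout_cut[OF m True] by simp
    next
      case False
      let ?X = "ending_at (walks K) (tail H e)" and ?Y = "extendable (walks K) e"
      have arms: "arm (walks K) i = sprout m i" if "i \<in> in_arcs H (tail H e)" for i
      proof (cases "i \<in> Z")
        case True
        have "i \<in> arcs H" using that by simp
        then have "card (arm (walks K) i) = 0" using card weightingD(1)[OF m] True by simp
        moreover have "finite (arm (walks K) i)" using finite_clique_tree[OF K] by (simp add: arm_def)
        ultimately show ?thesis using sprout_cut[OF m True] by simp
      next
        case False
        then show ?thesis using 1 that \<open>e \<notin> Z\<close> by (simp add: succ_rel_def)
      qed
      then have X: "?X = sprouts_at m (tail H e)"
        using ending_at_arms[OF good] by (simp add: sprouts_at_def)
      have "finite_order (before (col e)) ?X"
        by (rule finite_order_before[OF _ ending_at_source_walks[OF good]])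
          (use finite_clique_tree[OF K] in \<open>simp add: ending_at_def\<close>)
      moreover have "x \<in> ?Y" if a: "a \<in> ?Y" "x \<in> ?X" "before (col e) x a" for a x
      proof (rule ccontr)
        assume "x \<notin> ?Y"
        then obtain e' where e': "e' \<in> out_arcs H (tail H e)" "x \<in> extendable (walks K) e'" "e' \<noteq> e"
          using ending_at_extendable[OF good v] a(1,2) \<open>x \<notin> ?Y\<close> by blast
        then show False
          using extendable_noncrossing[OF clique_noncrossing[OF K] a(1) e'(2)] a(3) e'(1,3) by auto
      qed
      moreover have "?Y \<subseteq> ?X" by (auto simp: extendable_def)
      ultimately have "?Y = seg (before (col e)) (card ?Y) ?X"
        using finite_order.seg_unique by blast
      moreover have "card ?Y = m e" using card_arm_extendable[OF good v] card[OF 1(2)] by simp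
      ultimately show ?thesis
        using arm_snoc_extendable[OF good v] sprout_internal[OF m 1(2) v] X by simp
    qed
  qed
qed

end

section \<open>The maximal clique built from a weighting\<close>

locale weighted_graph = cut_graph H col Z for H :: "('a, 'b) pre_digraph" and col Z +
  fixes m :: "'b \<Rightarrow> nat"
  assumes weighting: "weighting Z m"
begin

lemma weight_out:
  assumes "internal H v" "out_arcs H v = {e, e'}" "e \<noteq> e'"
  shows "m e + m e' = sum m (in_arcs H v) + (if v \<in> tail H ` Z then 0 else 1)"
  using weightingD(3)[OF weighting assms(1)] assms by simp

text \<open>The other out-arc either has weight at least 1, which absorbs the excess, or is cut, and
  then there is no excess. So a segment of size \<open>m e\<close> exists.\<close>

lemma weight_le:
  assumes "internal H (tail H e)" "e \<in> arcs H"
  shows "m e \<le> sum m (in_arcs H (tail H e))"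
proof -
  have "e \<in> out_arcs H (tail H e)" using assms by simp
  then obtain e' where e': "out_arcs H (tail H e) = {e, e'}" "e \<noteq> e'"
    by (rule out_arcs_pair[OF assms(1)])
  have "e' \<in> out_arcs H (tail H e)" using e' by simp
  then have "e' \<in> Z" if "m e' = 0" using weightingD(1)[OF weighting, of e'] that by simp
  moreover have "tail H e = tail H e'" using \<open>e' \<in> _\<close> by simp
  ultimately show ?thesis using weight_out[OF assms(1) e'] by (cases "m e' = 0") (auto split: if_splits)
qed

text \<open>Size and shape are proved together: segments have the prescribed size only in a finite
  order, and \<open>before\<close> is one only on source walks with a common tip.\<close>

lemma sprout_properties:
  assumes "e \<in> arcs H"
  shows "card (sprout m e) = m e \<and>
    (\<forall>a \<in> sprout m e. a \<in> source_walks (head H e) \<and> last a = e \<and> set a \<inter> Z = {})"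
  using assms
proof (induction e rule: wf_induct_rule[OF wf_succ_rel(1)])
  case (1 e)
  show ?case
  proof (cases "internal H (tail H e)")
    case False
    then have s: "source H (tail H e)" using not_internal_tail 1(2) by blast
    have "e \<notin> Z" using False cut_internal by blast
    then show ?thesis
      using sprout_source[OF s] weightingD(2)[OF weighting 1(2) s] s 1(2) by (simp add: source_walks_def)
  next
    case v: True
    show ?thesis
    proof (cases "e \<in> Z")
      case True
      then show ?thesis using sprout_cut[OF weighting True] weightingD(1)[OF weighting 1(2)] by simp
    next
      case False
      have IH: "card (sprout m i) = m i \<and>
         (\<forall>a \<in> sprout m i. a \<in> source_walks (tail H e) \<and> last a = i \<and> set a \<inter> Z = {})"
        if "i \<in> in_arcs H (tail H e)" for i
      proof (cases "i \<in> Z")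
        case True
        then show ?thesis using sprout_cut[OF weighting True] weightingD(1)[OF weighting, of i] that by simp
      next
        case False
        then have "(i, e) \<in> succ_rel" using that 1(2) \<open>e \<notin> Z\<close> by (simp add: succ_rel_def)
        then show ?thesis using 1(1)[of i] that by auto
      qed
      \<comment> \<open>A nonzero cardinality already means finiteness, as \<open>card\<close> of an
        infinite set is 0; weight zero means a cut arc, whose sprout is empty.\<close>
      have fin: "finite (sprout m i)" if "i \<in> in_arcs H (tail H e)" for i
      proof (cases "m i = 0")
        case True
        then show ?thesis using sprout_cut[OF weighting, of i] weightingD(1)[OF weighting, of i] that by simp
      next
        case False
        then show ?thesis using IH[OF that] by (metis card.infinite)
      qed
      let ?X = "sprouts_at m (tail H e)"
      have X: "finite ?X"
        unfolding sprouts_at_def by (rule finite_UN_I[OF finite_in_arcs fin])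
      have X_source: "?X \<subseteq> source_walks (tail H e)"
        unfolding sprouts_at_def using IH by blast
      have X_cut: "set a \<inter> Z = {}" if "a \<in> ?X" for a
        using IH that unfolding sprouts_at_def by blast
      have "card ?X = (\<Sum>i \<in> in_arcs H (tail H e). card (sprout m i))"
        unfolding sprouts_at_def
      proof (rule card_UN_disjoint)
        show "\<forall>i \<in> in_arcs H (tail H e). \<forall>j \<in> in_arcs H (tail H e). i \<noteq> j \<longrightarrow> sprout m i \<inter> sprout m j = {}"
        proof (intro ballI impI)
          fix i j assume "i \<in> in_arcs H (tail H e)" "j \<in> in_arcs H (tail H e)" "i \<noteq> j"
          then show "sprout m i \<inter> sprout m j = {}" using IH[of i] IH[of j] by auto
        qed
        show "\<forall>i \<in> in_arcs H (tail H e). finite (sprout m i)" using fin by (intro ballI)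
      qed (rule finite_in_arcs)
      also have "\<dots> = sum m (in_arcs H (tail H e))" using IH by (intro sum.cong) auto
      finally have "m e \<le> card ?X" using weight_le[OF v 1(2)] by simp
      then have "card (seg (before (col e)) (m e) ?X) = m e"
        using finite_order.card_seg finite_order_before[OF X X_source] by blast
      then have "card (sprout m e) = m e"
        unfolding sprout_internal[OF weighting 1(2) v] by (subst card_image) (auto simp: inj_on_def)
      moreover have "a @ [e] \<in> source_walks (head H e) \<and> set (a @ [e]) \<inter> Z = {}" if "a \<in> ?X" for a
        using X_source X_cut[OF that] that 1(2) False by (auto simp: source_walks_def linked_append)
      ultimately show ?thesis
        unfolding sprout_internal[OF weighting 1(2) v] by (auto simp: seg_def)
    qed
  qed
qed

lemma card_sprout: "e \<in> arcs H \<Longrightarrow> card (sprout m e) = m e"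
  and sprout_source_walks: "e \<in> arcs H \<Longrightarrow> a \<in> sprout m e \<Longrightarrow> a \<in> source_walks (head H e)"
  and sprout_last: "e \<in> arcs H \<Longrightarrow> a \<in> sprout m e \<Longrightarrow> last a = e"
  and sprout_avoids_cut: "e \<in> arcs H \<Longrightarrow> a \<in> sprout m e \<Longrightarrow> set a \<inter> Z = {}"
  using sprout_properties by auto

lemma finite_sprout: "e \<in> arcs H \<Longrightarrow> finite (sprout m e)"
  using card_sprout[of e] weightingD(1)[OF weighting, of e] sprout_cut[OF weighting, of e]
  by (cases "m e = 0") (auto intro: card_ge_0_finite)

lemma finite_sprouts_at: "finite (sprouts_at m v)"
  unfolding sprouts_at_def by (rule finite_UN_I[OF finite_in_arcs], rule finite_sprout) simp

lemma sprouts_at_order: "finite_order (before c) (sprouts_at m v)"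
  by (rule finite_order_before[OF finite_sprouts_at, of _ v])
    (auto simp: sprouts_at_def dest: sprout_source_walks)

lemma card_sprouts_at: "card (sprouts_at m v) = sum m (in_arcs H v)"
proof -
  have "card (sprouts_at m v) = (\<Sum>i \<in> in_arcs H v. card (sprout m i))"
    unfolding sprouts_at_def
  proof (rule card_UN_disjoint)
    show "\<forall>i \<in> in_arcs H v. \<forall>j \<in> in_arcs H v. i \<noteq> j \<longrightarrow> sprout m i \<inter> sprout m j = {}"
    proof (intro ballI impI)
      fix i j assume "i \<in> in_arcs H v" "j \<in> in_arcs H v" "i \<noteq> j"
      then show "sprout m i \<inter> sprout m j = {}" using sprout_last[of i] sprout_last[of j] by auto
    qed
    show "\<forall>i \<in> in_arcs H v. finite (sprout m i)" using finite_sprout by simp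
  qed (rule finite_in_arcs)
  then show ?thesis using card_sprout by simp
qed

lemma card_seg_sprouts:
  assumes "internal H (tail H e)" "e \<in> arcs H"
  shows "card (seg (before (col e)) (m e) (sprouts_at m (tail H e))) = m e"
  using finite_order.card_seg[OF sprouts_at_order] weight_le[OF assms] card_sprouts_at by simp

text \<open>The orders of the two out-arcs are converse, and the weights add up to at least the
  number of sprouts; so the segments, taken from opposite ends, leave no gap.\<close>

lemma sprout_cover:
  assumes "internal H v" "out_arcs H v = {e, e'}" "e \<noteq> e'" "a \<in> sprouts_at m v"
  shows "a \<in> seg (before (col e)) (m e) (sprouts_at m v) \<or>
         a \<in> seg (before (col e')) (m e') (sprouts_at m v)"
proof -
  have "e \<in> out_arcs H v" "e' \<in> out_arcs H v" using assms(2) by auto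
  then have "col e \<noteq> col e'" using out_arc_eq[of e e'] assms(3) by auto
  then have "(\<lambda>x y. before (col e) y x) = before (col e')"
    using before_flip by (intro ext) blast
  moreover have "card (sprouts_at m v) \<le> m e + m e'"
    using weight_out[OF assms(1-3)] card_sprouts_at by simp
  ultimately show ?thesis using finite_order.seg_cover[OF sprouts_at_order _ assms(4)] by metis
qed

definition full_sprouts :: "'b list set" where
  "full_sprouts = {a. \<exists>e \<in> arcs H. a \<in> sprout m e \<and> sink H (head H e)}"

lemma sprout_snoc_internal:
  assumes "e \<in> arcs H" "b @ [e] \<in> sprout m e" "b \<noteq> []"
  shows "internal H (tail H e)" "b \<in> sprouts_at m (tail H e)"
    "b \<in> seg (before (col e)) (m e) (sprouts_at m (tail H e))"
proof -
  show v: "internal H (tail H e)"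
  proof (rule ccontr)
    assume "\<not> ?thesis"
    then have "sprout m e = {[e]}" using sprout_source not_internal_tail assms(1) by blast
    then show False using assms(2,3) by simp
  qed
  show "b \<in> seg (before (col e)) (m e) (sprouts_at m (tail H e))"
    using assms(2) sprout_internal[OF weighting assms(1) v] by auto
  then show "b \<in> sprouts_at m (tail H e)" by (simp add: seg_def)
qed

lemma sprout_prefix:
  assumes "a @ q \<in> sprout m e" "e \<in> arcs H" "a \<noteq> []"
  shows "last a \<in> arcs H \<and> a \<in> sprout m (last a)"
  using assms(1,2)
proof (induction q arbitrary: e rule: rev_induct)
  case Nil
  then show ?case using sprout_last[OF Nil(2), of a] assms(3) by simp
next
  case (snoc x q)
  have "x = e" using sprout_last[OF snoc(3,2)] by simp
  then have "(a @ q) @ [e] \<in> sprout m e" using snoc(2) by simp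
  then have "a @ q \<in> sprouts_at m (tail H e)" using sprout_snoc_internal(2)[OF snoc(3)] assms(3) by blast
  then show ?case using snoc(1) by (auto simp: sprouts_at_def)
qed

text \<open>At an internal vertex a sprout belongs to the segment of some out-arc, and acyclicity
  ends its growth at a sink.\<close>

lemma sprout_extends:
  assumes "e \<in> arcs H" "a \<in> sprout m e"
  shows "\<exists>q. a @ q \<in> full_sprouts"
  using assms
proof (induction e arbitrary: a rule: wf_induct_rule[OF wf_succ_rel(2)])
  case (1 e)
  show ?case
  proof (cases "internal H (head H e)")
    case False
    then have "a @ [] \<in> full_sprouts" using not_internal_head 1 unfolding full_sprouts_def by auto
    then show ?thesis by blast
  next
    case True
    obtain g where g_out: "g \<in> out_arcs H (head H e)" using colour_arc(2)[OF True] by blast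
    obtain g' where g': "out_arcs H (head H e) = {g, g'}" "g \<noteq> g'" by (rule out_arcs_pair[OF True g_out])
    have "a \<in> sprouts_at m (head H e)" using 1 by (auto simp: sprouts_at_def)
    then obtain f where f: "f \<in> out_arcs H (head H e)" "a \<in> seg (before (col f)) (m f) (sprouts_at m (head H e))"
      using sprout_cover[OF True g'] g'(1) by blast
    have fa: "f \<in> arcs H" "tail H f = head H e" using f by auto
    then have af: "a @ [f] \<in> sprout m f" using sprout_internal[OF weighting, of f] f(2) True by auto
    then have "f \<notin> Z" using sprout_cut[OF weighting] by blast
    moreover have "e \<notin> Z" using 1(3) sprout_cut[OF weighting] by blast
    ultimately have "(f, e) \<in> succ_rel\<inverse>" using fa 1(2) by (simp add: succ_rel_def)
    then obtain q where "(a @ [f]) @ q \<in> full_sprouts" using 1(1) fa(1) af by blast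
    then show ?thesis by (metis append.assoc)
  qed
qed

lemma tree_full_sprouts: "tree full_sprouts = (\<Union>e \<in> arcs H. sprout m e)"
proof (intro equalityI subsetI)
  fix a assume "a \<in> tree full_sprouts"
  then obtain q e where "a \<noteq> []" "e \<in> arcs H" "a @ q \<in> sprout m e"
    by (auto simp: tree_def full_sprouts_def)
  then show "a \<in> (\<Union>e \<in> arcs H. sprout m e)" using sprout_prefix by blast
next
  fix a assume "a \<in> (\<Union>e \<in> arcs H. sprout m e)"
  then obtain e where e: "e \<in> arcs H" "a \<in> sprout m e" by blast
  then show "a \<in> tree full_sprouts"
    using sprout_extends[OF e] sprout_source_walks[OF e] by (auto simp: tree_def source_walks_def)
qed

lemma tree_full_sprouts_last: "a \<in> tree full_sprouts \<Longrightarrow> last a \<in> arcs H \<and> a \<in> sprout m (last a)"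
  using sprout_last by (auto simp: tree_full_sprouts)

lemma arm_full_sprouts: "e \<in> arcs H \<Longrightarrow> arm full_sprouts e = sprout m e"
  using sprout_last by (auto simp: arm_def tree_full_sprouts)

lemma full_sprouts_good: "full_sprouts \<subseteq> {p. good_walk H p}"
proof
  fix p assume "p \<in> full_sprouts"
  then obtain e where e: "e \<in> arcs H" "p \<in> sprout m e" "sink H (head H e)"
    by (auto simp: full_sprouts_def)
  then show "p \<in> {p. good_walk H p}"
    using sprout_source_walks[OF e(1,2)] sprout_avoids_cut[OF e(1,2)] uncut_cycle_free[of p]
    by (simp add: good_walk_iff source_walks_def)
qed

text \<open>By \<open>seg_crossing\<close> a crossing requires weights exceeding the number of
  prefixes at the vertex by 2, but the excess is at most 1.\<close>

lemma full_sprouts_noncrossing: "noncrossing full_sprouts full_sprouts"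
  unfolding noncrossing_def
proof (intro allI impI notI, elim conjE)
  fix a e b e'
  assume ne: "a \<noteq> []" "b \<noteq> []" and T: "a @ [e] \<in> tree full_sprouts" "b @ [e'] \<in> tree full_sprouts"
    and tip: "tip a = tip b" "e \<noteq> e'" and bef: "before (col e) b a"
  have e: "e \<in> arcs H" "a @ [e] \<in> sprout m e" and e': "e' \<in> arcs H" "b @ [e'] \<in> sprout m e'"
    using tree_full_sprouts_last[OF T(1)] tree_full_sprouts_last[OF T(2)] by auto
  have tails: "tip a = tail H e" "tip b = tail H e'"
    using tree_snoc[OF full_sprouts_good T(1) ne(1)] tree_snoc[OF full_sprouts_good T(2) ne(2)] by auto
  define v where "v = tail H e"
  have v: "tail H e' = v" "tail H e = v" using tails tip by (auto simp: v_def)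
  note a = sprout_snoc_internal[OF e ne(1), unfolded v]
  note b = sprout_snoc_internal[OF e' ne(2), unfolded v]
  have out: "out_arcs H v = {e, e'}" using other_out_arc[OF a(1) _ _ tip(2)] e e' v by simp
  have "col e \<noteq> col e'" using out_arc_eq[of e e'] e e' v tip(2) by auto
  then have "(\<lambda>x y. before (col e) y x) = before (col e')"
    using before_flip by (intro ext) blast
  then have "card (sprouts_at m v) + 2 \<le> m e + m e'"
    using finite_order.seg_crossing[OF sprouts_at_order a(3) _ bef, of "m e'"] b(3) by simp
  then show False using weight_out[OF a(1) out tip(2)] card_sprouts_at[of v] by (simp split: if_splits)
qed

definition sprout_clique :: "'b route set" where
  "sprout_clique = Cycle ` {C. minimal_cycle H C} \<union> Walk ` full_sprouts"

lemma walks_sprout_clique: "walks sprout_clique = full_sprouts"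
  by (auto simp: walks_def sprout_clique_def)

lemma clique_sprout_clique: "clique H col sprout_clique"
  unfolding clique_def
proof
  show "sprout_clique \<subseteq> Routes H"
    using full_sprouts_good by (auto simp: sprout_clique_def Routes_def)
  have "\<not> incompatible H col (Walk p) (Walk p')" if "p \<in> full_sprouts" "p' \<in> full_sprouts" for p p'
  proof -
    have "noncrossing {p} {p'}"
      using full_sprouts_noncrossing that unfolding noncrossing_def tree_def by blast
    moreover have "linked p" "linked p'" using full_sprouts_good that good_walk_iff by auto
    ultimately show ?thesis using noncrossing_not_crossing by simp
  qed
  then show "pairwise (\<lambda>\<rho> \<rho>'. \<not> incompatible H col \<rho> \<rho>') sprout_clique"
    unfolding pairwise_def sprout_clique_def by auto
qed

lemma clique_flow_sprout_clique: "clique_flow H sprout_clique = flow_of m"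
proof -
  have "clique_flow H sprout_clique = flow_of (\<lambda>e. card (arm full_sprouts e))"
    using clique_flow_eq[OF clique_sprout_clique] by (simp add: sprout_clique_def walks_sprout_clique[unfolded sprout_clique_def])
  also have "\<dots> = flow_of m"
    unfolding flow_of_def using arm_full_sprouts card_sprout by (intro restrict_ext) simp
  finally show ?thesis .
qed

text \<open>This gives maximality. If \<open>a\<close> continued along \<open>e\<close> without
  lying in the segment of \<open>e\<close>, the prefix shared by both segments would precede
  \<open>a\<close> in the order of \<open>col e\<close> and also take \<open>e'\<close>, a
  crossing.\<close>

lemma larger_clique_tree:
  assumes K: "clique H col K" and sub: "sprout_clique \<subseteq> K" and "a \<in> tree (walks K)"
  shows "a \<in> tree full_sprouts"
  using assms(3)
proof (induction a rule: rev_induct)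
  case Nil
  then show ?case by (simp add: tree_def)
next
  case (snoc e a)
  note good = clique_good_walks[OF K]
  have sub_tree: "tree full_sprouts \<subseteq> tree (walks K)"
    using sub unfolding tree_def walks_def sprout_clique_def by blast
  have sprout_tree: "x \<in> tree (walks K)" if "x \<in> sprout m g" "g \<in> arcs H" for x g
    using sub_tree that tree_full_sprouts by blast
  have "last (a @ [e]) \<in> arcs H"
    using tree_source_walks(1)[OF good snoc(2)] linked_arcs[of "a @ [e]"] by (auto simp: source_walks_def)
  then have e: "e \<in> arcs H" by simp
  show ?case
  proof (cases "a = []")
    case True
    then have "source H (tail H e)" using tree_source_walks(1)[OF good snoc(2)] by (simp add: source_walks_def)
    then show ?thesis using sprout_source[of e m] e True by (auto simp: tree_full_sprouts)
  next
    case False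
    note at = tree_snoc[OF good snoc(2) False]
    have aT: "a \<in> tree full_sprouts" using snoc(1) at(1) by simp
    have v: "internal H (tail H e)"
      using tree_full_sprouts_last[OF aT] internal_between(2)[of "last a" e] at by simp
    define X where "X = sprouts_at m (tail H e)"
    have aX: "a \<in> X"
      using tree_full_sprouts_last[OF aT] at(2) unfolding X_def sprouts_at_def by auto
    have "e \<in> out_arcs H (tail H e)" using e by simp
    then obtain e' where e': "out_arcs H (tail H e) = {e, e'}" "e \<noteq> e'" by (rule out_arcs_pair[OF v])
    have "e' \<in> out_arcs H (tail H e)" using e' by simp
    then have te': "tail H e' = tail H e" "e' \<in> arcs H" by auto
    have "a \<in> seg (before (col e)) (m e) X"
    proof (rule ccontr)
      assume notR: "a \<notin> seg (before (col e)) (m e) X"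
      have aB: "a \<in> seg (before (col e')) (m e') X"
        using sprout_cover[OF v e'] aX notR unfolding X_def by blast
      have "e \<notin> Z"
      proof
        assume "e \<in> Z"
        then obtain C where C: "minimal_cycle H C" "e \<in> C" using cut_cycle by blast
        obtain d where d: "d \<in> C" "\<And>x. x \<in> tree (walks K) \<Longrightarrow> last x \<noteq> d"
          using clique_cycle_unused_arc[OF K C(1)] by blast
        have da: "d \<in> arcs H" using minimal_cycle_arcs[OF C(1) d(1)] .
        have "sprout m d = {}" using sprout_tree[OF _ da] sprout_last[OF da] d(2) by blast
        then have "d \<in> Z" using card_sprout[OF da] weightingD(1)[OF weighting da] by simp
        then have "d = e" using cycle_cut[OF C(1)] C(2) d(1) \<open>e \<in> Z\<close> by blast
        then show False using d(2)[OF snoc(2)] by simp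
      qed
      moreover have "e' \<notin> Z"
      proof
        assume "e' \<in> Z"
        then have "m e' = 0" using weightingD(1)[OF weighting te'(2)] by simp
        then show False using aB by (simp add: seg_def)
      qed
      ultimately have "tail H e \<notin> tail H ` Z"
        using e' cut_cycle minimal_cycle_arcs in_out_arcs_conv by (smt (verit) imageE insertE singletonD)
      then have sum: "m e + m e' = card X + 1"
        using weight_out[OF v e'] card_sprouts_at by (simp add: X_def)
      let ?R = "seg (before (col e)) (m e) X" and ?B = "seg (before (col e')) (m e') X"
      have "card ?R = m e" "card ?B = m e'"
        using card_seg_sprouts[OF v e] card_seg_sprouts[of e'] v te' by (simp_all add: X_def)
      moreover have "finite X" using finite_sprouts_at by (simp add: X_def)
      moreover have "?R \<union> ?B \<subseteq> X" by (auto simp: seg_def)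
      \<comment> \<open>The sizes add up to one more than \<open>card X\<close>, so the segments
        cannot be disjoint.\<close>
      ultimately have "?R \<inter> ?B \<noteq> {}"
        using sum card_mono[of X "?R \<union> ?B"] card_Un_disjoint[of ?R ?B] by (metis Un_upper1 Un_upper2
            add_le_same_cancel1 finite_subset not_one_le_zero order_trans)
      then obtain x where x: "x \<in> ?R" "x \<in> ?B" by blast
      have xX: "x \<in> X" using x(1) by (simp add: seg_def)
      have "x \<noteq> a" using x(1) notR by auto
      have "\<not> before (col e) a x"
        using finite_order.seg_down[OF sprouts_at_order, of x "col e" "m e" "tail H e" a] x(1) aX notR by (auto simp: X_def)
      then have "before (col e) x a"
        using finite_order.total[OF sprouts_at_order, of x "tail H e" a "col e"] xX aX \<open>x \<noteq> a\<close> by (auto simp: X_def)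
      moreover have "x @ [e'] \<in> tree (walks K)"
        using sprout_internal[OF weighting te'(2)] v te' x(2) by (intro sprout_tree[of _ e']) (auto simp: X_def)
      moreover have "x \<in> source_walks (tail H e)"
        using xX sprout_source_walks unfolding X_def sprouts_at_def by fastforce
      then have "x \<noteq> []" "tip x = tail H e" by (auto simp: source_walks_def)
      ultimately show False
        using noncrossingD[OF clique_noncrossing[OF K] snoc(2), of x e'] False e'(2) at(2) by simp
    qed
    then have "a @ [e] \<in> sprout m e" using sprout_internal[OF weighting e v] by (simp add: X_def)
    then show ?thesis using e by (auto simp: tree_full_sprouts)
  qed
qed

lemma sprout_clique_maximal: "sprout_clique \<in> maximal_cliques H col"
  unfolding maximal_cliques_def
proof (intro CollectI conjI allI impI clique_sprout_clique, elim conjE)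
  fix K assume K: "clique H col K" and sub: "sprout_clique \<subseteq> K"
  have "\<rho> \<in> sprout_clique" if "\<rho> \<in> K" for \<rho>
  proof (cases \<rho>)
    case (Cycle C)
    then show ?thesis using K that by (auto simp: clique_def Routes_def sprout_clique_def)
  next
    case (Walk p)
    then have p: "p \<in> walks K" using that by (simp add: walks_def)
    then have "good_walk H p" by (rule clique_good[OF K])
    then have "p \<noteq> []" "sink H (tip p)" by (auto simp: good_walk_iff)
    then have "p \<in> tree (walks K)" using p by (auto simp: tree_def intro!: exI[of _ "[]"])
    then have "p \<in> tree full_sprouts" by (rule larger_clique_tree[OF K sub])
    then have "p \<in> full_sprouts"
      using tree_full_sprouts_last \<open>sink H (tip p)\<close> unfolding full_sprouts_def by blast
    then show ?thesis using Walk by (simp add: sprout_clique_def)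
  qed
  then show "K = sprout_clique" using sub by blast
qed

end

section \<open>Injectivity and surjectivity\<close>

context framed_graph
begin

lemma maximal_clique_flow:
  assumes "K \<in> maximal_cliques H col"
  shows "clique_flow H K \<in> cyclic_volume_integer_flows H"
proof -
  have K: "clique H col K" using assms by (simp add: maximal_cliques_def)
  obtain Z where Z: "cut_graph H col Z" "\<And>a. a \<in> tree (walks K) \<Longrightarrow> last a \<notin> Z"
    using clique_cut[OF K] by blast
  interpret cut_graph H col Z by (rule Z(1))
  show ?thesis
    using clique_flow_eq[OF K maximal_clique_cycles[OF assms]]
      weighting_flow[OF maximal_clique_weighting[OF assms Z(2)]] by simp
qed

lemma flow_of_inject: "flow_of m = flow_of m' \<Longrightarrow> e \<in> arcs H \<Longrightarrow> m e = m' e"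
  by (auto simp: flow_of_def dest: fun_cong[of _ _ e])

text \<open>The cuts are taken from the flow and not from either clique, so that both cliques obey
  the same recursion and have the same arms. A walk is recovered from the arm of its last
  arc.\<close>

lemma clique_flow_inj: "inj_on (clique_flow H) (maximal_cliques H col)"
proof (rule inj_onI)
  fix K K'
  assume max: "K \<in> maximal_cliques H col" "K' \<in> maximal_cliques H col"
    and eq: "clique_flow H K = clique_flow H K'"
  define f where "f = clique_flow H K"
  have f: "f \<in> cyclic_volume_integer_flows H" unfolding f_def by (rule maximal_clique_flow[OF max(1)])
  define Z where "Z = {e \<in> arcs H. on_cycle e = 1 \<and> f e = 0}"
  interpret cut_graph H col Z unfolding Z_def by (rule flow_cut[OF f])
  obtain m where m: "weighting Z m" "f = flow_of m" unfolding Z_def by (rule flow_weighting[OF f])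
  have arm: "arm (walks L) e = sprout m e"
    if L: "L \<in> maximal_cliques H col" "clique_flow H L = f" and e: "e \<in> arcs H" for L e
  proof (rule clique_arm_sprout[OF _ m(1) _ e])
    show cl: "clique H col L" using L by (simp add: maximal_cliques_def)
    show "card (arm (walks L) e) = m e" if "e \<in> arcs H" for e
      using clique_flow_eq[OF cl maximal_clique_cycles[OF L(1)]] L(2) m(2)
      by (intro flow_of_inject[OF _ that]) simp
  qed
  have sub: "L \<subseteq> L'" if L: "L \<in> maximal_cliques H col" "clique_flow H L = f"
    "L' \<in> maximal_cliques H col" "clique_flow H L' = f" for L L'
  proof
    fix \<rho> assume \<rho>: "\<rho> \<in> L"
    have cl: "clique H col L" "clique H col L'" using L by (auto simp: maximal_cliques_def)
    show "\<rho> \<in> L'"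
    proof (cases \<rho>)
      case (Cycle C)
      then have "minimal_cycle H C" using cl(1) \<rho> by (auto simp: clique_def Routes_def)
      then show ?thesis using Cycle maximal_clique_cycles[OF L(3)] by simp
    next
      case (Walk p)
      then have p: "p \<in> walks L" using \<rho> by (simp add: walks_def)
      then have good: "good_walk H p" by (rule clique_good[OF cl(1)])
      then have p': "p \<noteq> []" "sink H (tip p)" "linked p" by (auto simp: good_walk_iff)
      then have e: "last p \<in> arcs H" using linked_arcs[of p] by auto
      have "p \<in> arm (walks L) (last p)" using p p'(1) by (auto simp: arm_def tree_def intro!: exI[of _ "[]"])
      then have "p \<in> arm (walks L') (last p)" using arm[OF L(1,2) e] arm[OF L(3,4) e] by simp
      then obtain q where q: "p @ q \<in> walks L'" by (auto simp: arm_def tree_def)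
      \<comment> \<open>Nothing continues past a sink, so the prefix is a whole walk of
        \<open>L'\<close>.\<close>
      have "q = []"
      proof (rule ccontr)
        assume "q \<noteq> []"
        have "linked (p @ q)" using clique_good[OF cl(2) q] by (simp add: good_walk_iff)
        then have "tip p = tail H (hd q)" "hd q \<in> arcs H"
          using p'(1) \<open>q \<noteq> []\<close> linked_arcs[of q] by (auto simp: linked_append)
        then show False using not_sink_tail[of "hd q"] p'(2) by simp
      qed
      then show ?thesis using q Walk by (simp add: walks_def)
    qed
  qed
  have "clique_flow H K = f" "clique_flow H K' = f" using eq by (simp_all add: f_def)
  then show "K = K'" by (intro equalityI sub max)
qed

lemma clique_flow_surj:
  assumes f: "f \<in> cyclic_volume_integer_flows H"
  shows "\<exists>K \<in> maximal_cliques H col. clique_flow H K = f"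
proof -
  define Z where "Z = {e \<in> arcs H. on_cycle e = 1 \<and> f e = 0}"
  interpret cut_graph H col Z unfolding Z_def by (rule flow_cut[OF f])
  obtain m where m: "weighting Z m" "f = flow_of m" unfolding Z_def by (rule flow_weighting[OF f])
  interpret weighted_graph H col Z m by unfold_locales (rule m(1))
  show ?thesis using sprout_clique_maximal clique_flow_sprout_clique m(2) by metis
qed

end

theorem theorem6p26:
  fixes H :: "('a, 'b) pre_digraph" and col :: "'b \<Rightarrow> colour"
  assumes "full_graph H"
    and "cyclic_ample_framing H col"
    and "loops_avoid_longer_cycles H"
  shows "bij_betw (clique_flow H) (maximal_cliques H col) (cyclic_volume_integer_flows H)"
proof -
  interpret framed_graph H col
    using assms by (simp add: framed_graph_def framed_graph_axioms_def)
  show ?thesis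
    unfolding bij_betw_def using clique_flow_inj maximal_clique_flow clique_flow_surj by blast
qed

end
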